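(* Let $\mathcal{A},\mathcal{Z}$ be finite nonempty sets, $u:\mathcal{A}\times\mathcal{Z}\to\mathbb{R}$, $c:\mathcal{A}\times\mathcal{Z}\to(0,\infty)$, and $v=(u,c):\mathcal{A}\times\mathcal{Z}\to\mathbb{R}^2$. For $q\in\Delta(\mathcal{Z})$ let $P^*(q)=\operatorname*{argmax}_{p\in\Delta(\mathcal{A})}\frac{u(p,q)}{c(p,q)}$, $A^*(q)=\operatorname*{argmax}_{a\in\mathcal{A}}\frac{u(a,q)}{c(a,q)}$, and $$\rho_1(q)=\inf\left\{\frac{\sum_{j=1}^J u(a_j,q_j)}{\sum_{j=1}^J c(a_j,q_j)}\,:\,1\le J<\infty,\ q_j\in\Delta(\mathcal{Z}),\ \frac1J\sum_{j=1}^J q_j=q,\ a_j\in A^*(q_j)\right\}.$$ Suppose the agent plays as follows. At time $n=1$ it uses an arbitrary mixed action $p_1$ and sets arbitrary values $v_1^*\in\mathbb{R}^2$, $q_1^*\in\Delta(\mathcal{Z})$. At each time $n\ge2$ it sets $$\lambda_{v,n-1}=\frac1{n-1}\sum_{k=1}^{n-1}\big(v_k^*-v(p_k,z_k)\big),\qquad \lambda_{q,n-1}=\frac1{n-1}\sum_{k=1}^{n-1}q_k^*-\bar q_{n-1},$$ chooses $$p_n\in\operatorname*{argmax}_{p\in\Delta(\mathcal{A})}\min_{q\in\Delta(\mathcal{Z})}\big(\lambda_{v,n-1}\cdot v(p,q)+\lambda_{q,n-1}\cdot q\big),\quad q_n^*\in\operatorname*{argmin}_{q\in\Delta(\mathcal{Z})}\max_{p\in\Delta(\mathcal{A})}\big(\lambda_{v,n-1}\cdot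 v(p,q)+\lambda_{q,n-1}\cdot q\big),$$ samples $a_n$ from $p_n$, picks any $p_n^*\in P^*(q_n^* )$, and sets $v_n^*=\big(u(p_n^*,q_n^* ),c(p_n^*,q_n^* )\big)$. Then, for any strategy of the opponent, $$\liminf_{n\to\infty}\left(\frac{\bar U_n}{\bar C_n}-\rho_1(\bar q_n)\right)\ge0\quad\text{almost surely.}$$
   Context: Repeated game: at each time $n$, given the history $(a_1,z_1,\dots,a_{n-1},z_{n-1})$, the agent samples $a_n$ from its mixed action $p_n\in\Delta(\mathcal{A})$ and the opponent samples $z_n\in\mathcal{Z}$ (conditionally independently) from a history-dependent distribution given by its strategy; $z_n$ is then observed by the agent. $\Delta(X)$ is the set of probability vectors on the finite set $X$; $u(p,q)=\sum_{a,z}p(a)q(z)u(a,z)$, $u(a,q)=\sum_z q(z)u(a,z)$, $v(p,z)=\sum_a p(a)v(a,z)$, and similarly for $c$, $v$. $\bar U_n=\frac1n\sum_{k=1}^n u(a_k,z_k)$, $\bar C_n=\frac1n\sum_{k=1}^n c(a_k,z_k)$, and $\bar q_n\in\Delta(\mathcal{Z})$ is the empirical distribution of $z_1,\dots,z_n$. *)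

theory Defs
  imports "HOL-Probability.Probability"
begin

definition prob_simplex :: "(real ^ 'n) set" where
  "prob_simplex = {p. (\<forall>i. 0 \<le> p $ i) \<and> (\<Sum>i\<in>UNIV. p $ i) = 1}"

text \<open>
  Multilinear extensions of \<open>w : A \<times> Z \<rightarrow> V\<close>: \<open>mix w p q\<close>, \<open>mix_left w p z\<close> and
  \<open>mix_right w a q\<close> are \<open>w(p,q)\<close>, \<open>w(p,z)\<close> and \<open>w(a,q)\<close>.
\<close>

definition mix :: "('a::finite \<Rightarrow> 'z::finite \<Rightarrow> 'v::real_vector) \<Rightarrow> real ^ 'a \<Rightarrow> real ^ 'z \<Rightarrow> 'v" where
  "mix w p q = (\<Sum>a\<in>UNIV. \<Sum>z\<in>UNIV. (p $ a * q $ z) *\<^sub>R w a z)"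

definition mix_left :: "('a::finite \<Rightarrow> 'z \<Rightarrow> 'v::real_vector) \<Rightarrow> real ^ 'a \<Rightarrow> 'z \<Rightarrow> 'v" where
  "mix_left w p z = (\<Sum>a\<in>UNIV. p $ a *\<^sub>R w a z)"

definition mix_right :: "('a \<Rightarrow> 'z::finite \<Rightarrow> 'v::real_vector) \<Rightarrow> 'a \<Rightarrow> real ^ 'z \<Rightarrow> 'v" where
  "mix_right w a q = (\<Sum>z\<in>UNIV. q $ z *\<^sub>R w a z)"

definition pair_payoff :: "('a \<Rightarrow> 'z \<Rightarrow> real) \<Rightarrow> ('a \<Rightarrow> 'z \<Rightarrow> real) \<Rightarrow> 'a \<Rightarrow> 'z \<Rightarrow> real \<times> real" where
  "pair_payoff u c a z = (u a z, c a z)"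

definition best_mixed ::
    "('a::finite \<Rightarrow> 'z::finite \<Rightarrow> real) \<Rightarrow> ('a \<Rightarrow> 'z \<Rightarrow> real) \<Rightarrow> real ^ 'z \<Rightarrow> (real ^ 'a) set" where
  "best_mixed u c q =
     {p. is_arg_max (\<lambda>p. mix u p q / mix c p q) (\<lambda>p. p \<in> prob_simplex) p}"

definition best_pure ::
    "('a \<Rightarrow> 'z::finite \<Rightarrow> real) \<Rightarrow> ('a \<Rightarrow> 'z \<Rightarrow> real) \<Rightarrow> real ^ 'z \<Rightarrow> 'a set" where
  "best_pure u c q =
     {a. is_arg_max (\<lambda>a. mix_right u a q / mix_right c a q) (\<lambda>_. True) a}"

text \<open>
  For \<open>c > 0\<close> and \<open>q\<close> in the simplex the set below is nonempty and bounded, so the real-valued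
  \<open>Inf\<close> is the usual infimum.
\<close>

definition rho1 ::
    "('a::finite \<Rightarrow> 'z::finite \<Rightarrow> real) \<Rightarrow> ('a \<Rightarrow> 'z \<Rightarrow> real) \<Rightarrow> real ^ 'z \<Rightarrow> real" where
  "rho1 u c q =
     Inf {(\<Sum>j\<in>{1..J}. mix_right u (a j) (r j)) / (\<Sum>j\<in>{1..J}. mix_right c (a j) (r j)) | J a r.
            1 \<le> (J::nat) \<and> (\<forall>j\<in>{1..J}. r j \<in> prob_simplex) \<and>
            (1 / real J) *\<^sub>R (\<Sum>j\<in>{1..J}. r j) = q \<and>
            (\<forall>j\<in>{1..J}. a j \<in> best_pure u c (r j))}"

text \<open>
  Histories are lists of action pairs in chronological order: \<open>h ! k\<close> is the pair
  \<open>(a\<^sub>k\<^sub>+\<^sub>1, z\<^sub>k\<^sub>+\<^sub>1)\<close>, and \<open>take k h\<close> is the history on which the stage \<open>k + 1\<close> choices are based.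
\<close>

type_synonym ('a, 'z) hist = "('a \<times> 'z) list"

definition avg_payoff :: "('a \<Rightarrow> 'z \<Rightarrow> real) \<Rightarrow> ('a, 'z) hist \<Rightarrow> real" where
  "avg_payoff w h = (1 / real (length h)) * (\<Sum>k<length h. w (fst (h ! k)) (snd (h ! k)))"

definition empirical :: "('a, 'z) hist \<Rightarrow> real ^ 'z" where
  "empirical h = (\<chi> z. real (card {k. k < length h \<and> snd (h ! k) = z}) / real (length h))"

text \<open>
  The agent's choices as functions of the history. Those made before stage \<open>n\<close> is played,
  \<open>p\<^sub>n = \<sigma> h\<close> and \<open>q\<^sub>n\<^sup>* = qs h\<close>, take the history \<open>h\<close> of length \<open>n - 1\<close>. Those used only
  from stage \<open>n + 1\<close> on, \<open>p\<^sub>n\<^sup>* = ps h\<close> and \<open>v\<^sub>n\<^sup>* = vs h\<close>, take the history \<open>h\<close> of length \<open>n\<close>,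
  so that they may depend on the sampled action.
\<close>

definition lambda_v ::
    "('a::finite \<Rightarrow> 'z \<Rightarrow> real) \<Rightarrow> ('a \<Rightarrow> 'z \<Rightarrow> real) \<Rightarrow> (('a, 'z) hist \<Rightarrow> real ^ 'a) \<Rightarrow>
     (('a, 'z) hist \<Rightarrow> real \<times> real) \<Rightarrow> ('a, 'z) hist \<Rightarrow> real \<times> real" where
  "lambda_v u c \<sigma> vs h = (1 / real (length h)) *\<^sub>R
     (\<Sum>k<length h. vs (take (Suc k) h) - mix_left (pair_payoff u c) (\<sigma> (take k h)) (snd (h ! k)))"

definition lambda_q :: "(('a, 'z::finite) hist \<Rightarrow> real ^ 'z) \<Rightarrow> ('a, 'z) hist \<Rightarrow> real ^ 'z" where
  "lambda_q qs h = (1 / real (length h)) *\<^sub>R (\<Sum>k<length h. qs (take k h)) - empirical h"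

definition aux_payoff ::
    "('a::finite \<Rightarrow> 'z::finite \<Rightarrow> real) \<Rightarrow> ('a \<Rightarrow> 'z \<Rightarrow> real) \<Rightarrow> real \<times> real \<Rightarrow> real ^ 'z \<Rightarrow>
     real ^ 'a \<Rightarrow> real ^ 'z \<Rightarrow> real" where
  "aux_payoff u c lv lq p q = lv \<bullet> mix (pair_payoff u c) p q + lq \<bullet> q"

text \<open>
  The inner \<open>INF\<close> and \<open>SUP\<close> are a minimum and a maximum, since \<open>aux_payoff\<close> is continuous and
  the simplex compact. At \<open>h = []\<close> only membership in the simplex is required, and \<open>vs\<close> is
  unconstrained on histories of length one, so \<open>p\<^sub>1\<close>, \<open>q\<^sub>1\<^sup>*\<close> and \<open>v\<^sub>1\<^sup>*\<close> are arbitrary.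
\<close>

definition follows_rule ::
    "('a::finite \<Rightarrow> 'z::finite \<Rightarrow> real) \<Rightarrow> ('a \<Rightarrow> 'z \<Rightarrow> real) \<Rightarrow> (('a, 'z) hist \<Rightarrow> real ^ 'a) \<Rightarrow>
     (('a, 'z) hist \<Rightarrow> real ^ 'z) \<Rightarrow> (('a, 'z) hist \<Rightarrow> real ^ 'a) \<Rightarrow>
     (('a, 'z) hist \<Rightarrow> real \<times> real) \<Rightarrow> bool" where
  "follows_rule u c \<sigma> qs ps vs \<longleftrightarrow>
     \<sigma> [] \<in> prob_simplex \<and> qs [] \<in> prob_simplex \<and>
     (\<forall>h. h \<noteq> [] \<longrightarrow>
        is_arg_max
          (\<lambda>p. INF q\<in>prob_simplex. aux_payoff u c (lambda_v u c \<sigma> vs h) (lambda_q qs h) p q)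
          (\<lambda>p. p \<in> prob_simplex) (\<sigma> h) \<and>
        is_arg_min
          (\<lambda>q. SUP p\<in>prob_simplex. aux_payoff u c (lambda_v u c \<sigma> vs h) (lambda_q qs h) p q)
          (\<lambda>q. q \<in> prob_simplex) (qs h) \<and>
        (\<forall>x. ps (h @ [x]) \<in> best_mixed u c (qs h) \<and>
             vs (h @ [x]) = (mix u (ps (h @ [x])) (qs h), mix c (ps (h @ [x])) (qs h))))"

text \<open>\<open>a k\<close> and \<open>z k\<close> are the actions of stage \<open>k + 1\<close>.\<close>

definition history :: "(nat \<Rightarrow> 'w \<Rightarrow> 'a) \<Rightarrow> (nat \<Rightarrow> 'w \<Rightarrow> 'z) \<Rightarrow> nat \<Rightarrow> 'w \<Rightarrow> ('a, 'z) hist" where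
  "history a z n \<omega> = map (\<lambda>k. (a k \<omega>, z k \<omega>)) [0..<n]"

text \<open>
  The random play generated by the strategies \<open>\<sigma>\<close> of the agent and \<open>\<tau>\<close> of the opponent: given the
  history, the two actions are independent with laws prescribed by \<open>\<sigma>\<close> and \<open>\<tau>\<close>.
\<close>

definition is_play ::
    "'w measure \<Rightarrow> (('a::finite, 'z::finite) hist \<Rightarrow> real ^ 'a) \<Rightarrow> (('a, 'z) hist \<Rightarrow> real ^ 'z) \<Rightarrow>
     (nat \<Rightarrow> 'w \<Rightarrow> 'a) \<Rightarrow> (nat \<Rightarrow> 'w \<Rightarrow> 'z) \<Rightarrow> bool" where
  "is_play M \<sigma> \<tau> a z \<longleftrightarrow>
     prob_space M \<and>
     (\<forall>k. a k \<in> M \<rightarrow>\<^sub>M count_space UNIV) \<and> (\<forall>k. z k \<in> M \<rightarrow>\<^sub>M count_space UNIV) \<and>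
     (\<forall>n h. \<P>(\<omega> in M. history a z n \<omega> = h) > 0 \<longrightarrow>
        (\<forall>x y. \<P>(\<omega> in M. a n \<omega> = x \<and> z n \<omega> = y \<bar> history a z n \<omega> = h) = \<sigma> h $ x * \<tau> h $ y))"

end

theory Submission
  imports Defs "HOL-Real_Asymp.Real_Asymp"
begin

text \<open>
  The minimax theorem for matrix games makes \<open>\<lambda>\<^sub>n\<^sub>-\<^sub>1\<close> have nonpositive inner product with the increment
  of \<open>n \<lambda>\<^sub>n\<close>; the increments are bounded, so \<open>\<lambda>\<^sub>n\<close> tends to \<open>0\<close> along every play. By a law of large numbers
  for martingale differences, \<open>v(p\<^sub>k, z\<^sub>k)\<close> may be replaced by \<open>v(a\<^sub>k, z\<^sub>k)\<close> on average, almost surely. Hence with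
  \<open>\<rho>\<close> the realized ratio, the averages of \<open>u\<^sub>k\<^sup>* - \<rho> c\<^sub>k\<^sup>*\<close> and of \<open>q\<^sub>k\<^sup>*\<close> are close to \<open>0\<close> and to the
  empirical distribution, respectively, and every \<open>p\<^sub>k\<^sup>*\<close> may be replaced by a pure best response to \<open>q\<^sub>k\<^sup>*\<close> without
  increasing \<open>u - \<rho> c\<close>. It remains to see that an approximate decomposition of \<open>q\<close>
  can be turned into an exact one at small cost, uniformly in \<open>q\<close>; this follows from a finite cover of
  the compact sets \<open>{q. a \<in> A\<^sup>*(q)}\<close> by sets of the form \<open>{q. q > (1 - \<eta>) f on the support of f}\<close>.
\<close>

subsection \<open>Mixed actions and ratio payoffs\<close>

lemma prob_simplexD: "p \<in> prob_simplex \<Longrightarrow> 0 \<le> p $ i" "p \<in> prob_simplex \<Longrightarrow> (\<Sum>i\<in>UNIV. p $ i) = 1"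
  by (auto simp: prob_simplex_def)

lemma axis_in_prob_simplex: "axis i 1 \<in> prob_simplex"
  by (simp add: prob_simplex_def axis_def)

lemma norm_prob_simplex_le: "norm p \<le> 1" if "p \<in> prob_simplex"
proof -
  have "norm p \<le> (\<Sum>i\<in>UNIV. \<bar>p $ i\<bar>)" by (rule norm_le_l1_cart)
  also have "\<dots> = 1" using that by (auto simp: prob_simplex_def)
  finally show ?thesis .
qed

lemma closed_prob_simplex: "closed (prob_simplex :: (real ^ 'n) set)"
proof -
  have "prob_simplex = (\<Inter>i. {p :: real ^ 'n. 0 \<le> p $ i}) \<inter> {p. (\<Sum>i\<in>UNIV. p $ i) = 1}"
    by (auto simp: prob_simplex_def)
  also have "closed \<dots>"
    by (intro closed_Int closed_INT ballI closed_Collect_le closed_Collect_eq continuous_intros)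
  finally show ?thesis .
qed

lemma compact_prob_simplex: "compact (prob_simplex :: (real ^ 'n) set)"
  unfolding compact_eq_bounded_closed
  using closed_prob_simplex norm_prob_simplex_le by (auto simp: bounded_iff)

lemma convex_prob_simplex: "convex (prob_simplex :: (real ^ 'n) set)"
  by (auto simp: convex_def prob_simplex_def sum.distrib simp flip: sum_distrib_left)

lemma simplex_average_bounds:
  assumes "p \<in> prob_simplex" "\<forall>i. m \<le> g i" "\<forall>i. g i \<le> M"
  shows "m \<le> (\<Sum>i\<in>UNIV. p $ i * g i)" "(\<Sum>i\<in>UNIV. p $ i * g i) \<le> (M::real)"
proof -
  have "m = (\<Sum>i\<in>UNIV. p $ i * m)" "M = (\<Sum>i\<in>UNIV. p $ i * M)"
    using assms(1) by (simp_all add: prob_simplex_def flip: sum_distrib_right)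
  moreover have "(\<Sum>i\<in>UNIV. p $ i * m) \<le> (\<Sum>i\<in>UNIV. p $ i * g i)"
    "(\<Sum>i\<in>UNIV. p $ i * g i) \<le> (\<Sum>i\<in>UNIV. p $ i * M)"
    using assms by (auto intro!: sum_mono mult_left_mono simp: prob_simplex_def)
  ultimately show "m \<le> (\<Sum>i\<in>UNIV. p $ i * g i)" "(\<Sum>i\<in>UNIV. p $ i * g i) \<le> M"
    by simp_all
qed

lemma mix_eq_mix_right: "mix w p q = (\<Sum>a\<in>UNIV. p $ a *\<^sub>R mix_right w a q)"
  by (simp add: mix_def mix_right_def scaleR_sum_right)

lemma mix_right_bounds:
  assumes "q \<in> prob_simplex" "\<forall>a z. m \<le> w a z" "\<forall>a z. w a z \<le> (M::real)"
  shows "m \<le> mix_right w a q" "mix_right w a q \<le> M"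
  using simplex_average_bounds[OF assms(1), of m "w a" M] assms(2,3) by (auto simp: mix_right_def)

lemma mix_bounds:
  assumes "p \<in> prob_simplex" "q \<in> prob_simplex" "\<forall>a z. m \<le> w a z" "\<forall>a z. w a z \<le> (M::real)"
  shows "m \<le> mix w p q" "mix w p q \<le> M"
  using simplex_average_bounds[OF assms(1), of m "\<lambda>a. mix_right w a q" M]
    mix_right_bounds[OF assms(2-4)] by (auto simp: mix_eq_mix_right)

lemma mix_axis: "mix w (axis a 1) q = mix_right w a q"
proof -
  have "mix w (axis a 1) q = (\<Sum>b\<in>UNIV. if b = a then mix_right w b q else 0)"
    unfolding mix_eq_mix_right by (intro sum.cong) (auto simp: axis_def)
  then show ?thesis by simp
qed

lemma bounded_payoff:
  fixes w :: "'a::finite \<Rightarrow> 'z::finite \<Rightarrow> real"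
  obtains K where "0 < K" "\<forall>a z. - K \<le> w a z" "\<forall>a z. w a z \<le> K" "\<forall>a z. \<bar>w a z\<bar> \<le> K"
proof
  \<comment> \<open>The summand 1 keeps the bound strictly positive even for the zero
    payoff.\<close>
  let ?K = "Max (range (\<lambda>(a, z). \<bar>w a z\<bar>)) + 1"
  have le: "\<bar>w a z\<bar> \<le> ?K - 1" for a z
    by (simp, rule Max_ge) (auto intro: range_eqI[of _ _ "(a, z)"])
  show "0 < ?K" using le[of undefined undefined] by linarith
  have "- ?K \<le> w a z \<and> w a z \<le> ?K \<and> \<bar>w a z\<bar> \<le> ?K" for a z
    using le[of a z] by linarith
  then show "\<forall>a z. - ?K \<le> w a z" "\<forall>a z. w a z \<le> ?K" "\<forall>a z. \<bar>w a z\<bar> \<le> ?K"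
    by blast+
qed

lemma positive_payoff_bounded_below:
  fixes c :: "'a::finite \<Rightarrow> 'z::finite \<Rightarrow> real"
  assumes "\<forall>x y. 0 < c x y"
  obtains m where "0 < m" "\<forall>a z. m \<le> c a z"
proof
  show "0 < Min (range (\<lambda>(a, z). c a z))"
    using assms by (subst Min_gr_iff) auto
  have "Min (range (\<lambda>(a, z). c a z)) \<le> c a z" for a z
    by (rule Min_le) (auto intro: range_eqI[of _ _ "(a, z)"])
  then show "\<forall>a z. Min (range (\<lambda>(a, z). c a z)) \<le> c a z"
    by blast
qed

lemma mix_right_pos:
  assumes "\<forall>x y. 0 < (c :: 'a::finite \<Rightarrow> 'z::finite \<Rightarrow> real) x y" "q \<in> prob_simplex"
  shows "0 < mix_right c a q"
proof -
  obtain m where m: "0 < m" "\<forall>a z. m \<le> c a z"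
    using positive_payoff_bounded_below[OF assms(1)] .
  obtain M where "\<forall>a z. c a z \<le> M" using bounded_payoff[of c] by metis
  from mix_right_bounds(1)[OF assms(2) m(2) this] m(1) show ?thesis
    by (rule less_le_trans[rotated])
qed

lemma mix_pos:
  assumes "\<forall>x y. 0 < (c :: 'a::finite \<Rightarrow> 'z::finite \<Rightarrow> real) x y" "p \<in> prob_simplex" "q \<in> prob_simplex"
  shows "0 < mix c p q"
proof -
  obtain m where m: "0 < m" "\<forall>a z. m \<le> c a z"
    using positive_payoff_bounded_below[OF assms(1)] .
  obtain M where "\<forall>a z. c a z \<le> M" using bounded_payoff[of c] by metis
  from mix_bounds(1)[OF assms(2,3) m(2) this] m(1) show ?thesis
    by (rule less_le_trans[rotated])
qed

section \<open>Best responses for the ratio payoff\<close>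

text \<open>Cross-multiplying by the positive costs turns the comparison of ratios into polynomial
  inequalities in \<open>q\<close>, from which closedness of the best-response regions can be read
  off.\<close>

lemma best_pure_iff:
  fixes u c :: "'a::finite \<Rightarrow> 'z::finite \<Rightarrow> real"
  assumes "\<forall>x y. 0 < c x y" "q \<in> prob_simplex"
  shows "a \<in> best_pure u c q \<longleftrightarrow>
    (\<forall>b. mix_right u b q * mix_right c a q \<le> mix_right u a q * mix_right c b q)"
proof -
  have "x / y \<le> x' / y' \<longleftrightarrow> x * y' \<le> x' * y" if "0 < y" "0 < y'" for x y x' y' :: real
    using that by (simp add: divide_simps)
  then show ?thesis
    using mix_right_pos[OF assms] by (simp add: best_pure_def is_arg_max_def not_less)
qed

lemma best_pure_nonempty: "best_pure u c q \<noteq> {}" for u c :: "'a::finite \<Rightarrow> 'z::finite \<Rightarrow> real"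
proof -
  let ?f = "\<lambda>a. mix_right u a q / mix_right c a q"
  have "Max (range ?f) \<in> range ?f" by (rule Max_in) auto
  then obtain a where "?f a = Max (range ?f)" by (metis (no_types, lifting) imageE)
  then have "a \<in> best_pure u c q"
    by (auto simp: best_pure_def is_arg_max_def not_less)
  then show ?thesis by auto
qed

lemma compact_best_pure_region:
  fixes u c :: "'a::finite \<Rightarrow> 'z::finite \<Rightarrow> real"
  assumes "\<forall>x y. 0 < c x y"
  shows "compact {q \<in> prob_simplex. a \<in> best_pure u c q}"
proof -
  have "{q \<in> prob_simplex. a \<in> best_pure u c q} = prob_simplex \<inter>
     (\<Inter>b. {q. mix_right u b q * mix_right c a q \<le> mix_right u a q * mix_right c b q})"
    using best_pure_iff[OF assms] by auto
  also have "compact \<dots>"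
    unfolding mix_right_def
    by (intro compact_Int_closed compact_prob_simplex closed_INT ballI closed_Collect_le continuous_intros)
  finally show ?thesis .
qed

text \<open>Let \<open>r\<close> be the best pure ratio at \<open>q\<close>. Every gap
  \<open>r * c(a,q) - u(a,q)\<close> is nonnegative, while its \<open>p\<close>-average is at most 0
  by optimality of \<open>p\<close>; so the gaps vanish on the support of \<open>p\<close>, which
  thus consists of pure best responses. As \<open>u - \<rho> c\<close> is linear in
  \<open>p\<close>, some action of the support does at most as well as the average.\<close>

lemma best_mixed_imp_pure:
  fixes u c :: "'a::finite \<Rightarrow> 'z::finite \<Rightarrow> real"
  assumes c: "\<forall>x y. 0 < c x y" and q: "q \<in> prob_simplex" and p: "p \<in> best_mixed u c q"
  obtains a where "a \<in> best_pure u c q"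
    "mix_right u a q - \<rho> * mix_right c a q \<le> mix u p q - \<rho> * mix c p q"
proof -
  let ?w = "\<lambda>a. mix_right u a q - \<rho> * mix_right c a q"
  obtain b where b: "b \<in> best_pure u c q" using best_pure_nonempty by blast
  define r where "r = mix_right u b q / mix_right c b q"
  note cpos = mix_right_pos[OF c q]
  have pS: "p \<in> prob_simplex" using p by (simp add: best_mixed_def is_arg_max_def)
  have gap: "0 \<le> r * mix_right c a q - mix_right u a q" for a
  proof -
    have "mix_right u a q / mix_right c a q \<le> r"
      using b by (auto simp: best_pure_def is_arg_max_def not_less r_def)
    then show ?thesis using cpos[of a] by (simp add: divide_simps)
  qed
  \<comment> \<open>The pure action \<open>b\<close>, seen as a vertex of the simplex, competes with
    \<open>p\<close>.\<close>
  have "\<not> mix u p q / mix c p q < mix u (axis b 1) q / mix c (axis b 1) q"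
    using p axis_in_prob_simplex[of b] by (auto simp: best_mixed_def is_arg_max_def)
  then have le: "r \<le> mix u p q / mix c p q" by (simp add: mix_axis r_def)
  have "0 < mix c p q" by (rule mix_pos[OF c pS q])
  with le have "r * mix c p q \<le> mix u p q" by (simp add: divide_simps)
  then have "(\<Sum>a\<in>UNIV. p $ a * (r * mix_right c a q - mix_right u a q)) \<le> 0"
    by (simp add: mix_eq_mix_right algebra_simps sum_subtractf sum_distrib_left)
  moreover have nn: "0 \<le> p $ a * (r * mix_right c a q - mix_right u a q)" for a
    using gap[of a] prob_simplexD(1)[OF pS] by simp
  ultimately have "(\<Sum>a\<in>UNIV. p $ a * (r * mix_right c a q - mix_right u a q)) = 0"
    using sum_nonneg[of UNIV "\<lambda>a. p $ a * (r * mix_right c a q - mix_right u a q)"] by force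
  then have z: "p $ a * (r * mix_right c a q - mix_right u a q) = 0" for a
    using nn by (subst (asm) sum_nonneg_eq_0_iff) auto
  have best: "a \<in> best_pure u c q" if "p $ a \<noteq> 0" for a
  proof -
    have "r = mix_right u a q / mix_right c a q" using z[of a] that cpos[of a] by (simp add: divide_simps)
    then show ?thesis using b by (auto simp: best_pure_def is_arg_max_def r_def)
  qed
  have "\<exists>a. p $ a \<noteq> 0 \<and> ?w a \<le> mix u p q - \<rho> * mix c p q"
  proof (rule ccontr)
    assume "\<not> ?thesis"
    then have less: "mix u p q - \<rho> * mix c p q < ?w a" if "p $ a \<noteq> 0" for a
      using that by force
    have "mix u p q - \<rho> * mix c p q = (\<Sum>a\<in>UNIV. p $ a * (mix u p q - \<rho> * mix c p q))"
      using pS by (simp add: prob_simplex_def flip: sum_distrib_right)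
    also have "\<dots> < (\<Sum>a\<in>UNIV. p $ a * ?w a)"
    proof (rule sum_strict_mono_ex1)
      show "\<forall>a\<in>UNIV. p $ a * (mix u p q - \<rho> * mix c p q) \<le> p $ a * ?w a"
        using less prob_simplexD(1)[OF pS] by (metis less_eq_real_def mult_left_mono mult_zero_left)
      obtain a where "p $ a \<noteq> 0" using prob_simplexD(2)[OF pS] by force
      then have "p $ a * (mix u p q - \<rho> * mix c p q) < p $ a * ?w a"
        using less[of a] prob_simplexD(1)[OF pS, of a] by (intro mult_strict_left_mono) auto
      then show "\<exists>a\<in>UNIV. p $ a * (mix u p q - \<rho> * mix c p q) < p $ a * ?w a" by blast
    qed simp
    also have "\<dots> = mix u p q - \<rho> * mix c p q"
      by (simp add: mix_eq_mix_right algebra_simps sum_subtractf sum_distrib_left)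
    finally show False by simp
  qed
  then show ?thesis using best that by blast
qed

section \<open>Bounds on \<open>rho1\<close> from exact decompositions\<close>

text \<open>Frees the decomposition from the index set \<open>{1..J}\<close>, so that later ones may
  be indexed by any finite set; the values are transported along a bijection.\<close>

lemma rho1_le:
  fixes u c :: "'a::finite \<Rightarrow> 'z::finite \<Rightarrow> real"
  assumes c: "\<forall>x y. 0 < c x y" and "finite I" "I \<noteq> {}"
    and r: "\<And>i. i \<in> I \<Longrightarrow> r i \<in> prob_simplex" and a: "\<And>i. i \<in> I \<Longrightarrow> a i \<in> best_pure u c (r i)"
    and q: "(\<Sum>i\<in>I. r i) = real (card I) *\<^sub>R q"
  shows "rho1 u c q \<le> (\<Sum>i\<in>I. mix_right u (a i) (r i)) / (\<Sum>i\<in>I. mix_right c (a i) (r i))"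
proof -
  obtain e where e: "bij_betw e {1..card I} I"
    using ex_bij_betw_nat_finite_1[OF \<open>finite I\<close>] by blast
  have card: "1 \<le> card I" using assms(2,3) by (simp add: Suc_leI card_gt_0_iff)
  have eI: "e j \<in> I" if "j \<in> {1..card I}" for j using e that by (auto simp: bij_betw_def)
  have sums: "(\<Sum>j\<in>{1..card I}. mix_right u (a (e j)) (r (e j))) = (\<Sum>i\<in>I. mix_right u (a i) (r i))"
    "(\<Sum>j\<in>{1..card I}. mix_right c (a (e j)) (r (e j))) = (\<Sum>i\<in>I. mix_right c (a i) (r i))"
    "(\<Sum>j\<in>{1..card I}. r (e j)) = (\<Sum>i\<in>I. r i)"
    using sum.reindex_bij_betw[OF e, of "\<lambda>i. mix_right u (a i) (r i)"]
      sum.reindex_bij_betw[OF e, of "\<lambda>i. mix_right c (a i) (r i)"] sum.reindex_bij_betw[OF e, of r]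
    by simp_all
  obtain m where m: "0 < m" "\<forall>x y. m \<le> c x y" using positive_payoff_bounded_below[OF c] .
  obtain C where Cb: "\<forall>x y. c x y \<le> C" using bounded_payoff[of c] by metis
  obtain K where K: "0 < K" and Kb: "\<forall>x y. - K \<le> u x y" "\<forall>x y. u x y \<le> K"
    using bounded_payoff[of u] by metis
  \<comment> \<open>A lower bound common to all admissible ratios: only for a set bounded below does
    the real \<open>Inf\<close> lie below each member.\<close>
  have lower: "- K / m \<le> (\<Sum>j\<in>{1..J}. mix_right u (b j) (s j)) / (\<Sum>j\<in>{1..J}. mix_right c (b j) (s j))"
    if J: "1 \<le> (J::nat)" "\<forall>j\<in>{1..J}. s j \<in> prob_simplex" for J b s
  proof -
    have "- K * real J = (\<Sum>j\<in>{1..J}. - K)" by simp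
    also have "\<dots> \<le> (\<Sum>j\<in>{1..J}. mix_right u (b j) (s j))"
      using J Kb by (intro sum_mono mix_right_bounds(1)[where M = K]) auto
    finally have n: "- K * real J \<le> (\<Sum>j\<in>{1..J}. mix_right u (b j) (s j))" .
    have "m * real J = (\<Sum>j\<in>{1..J}. m)" by simp
    also have "\<dots> \<le> (\<Sum>j\<in>{1..J}. mix_right c (b j) (s j))"
      using J m(2) Cb by (intro sum_mono mix_right_bounds(1)[where M = C]) auto
    finally have d: "m * real J \<le> (\<Sum>j\<in>{1..J}. mix_right c (b j) (s j))" .
    have dp: "0 < (\<Sum>j\<in>{1..J}. mix_right c (b j) (s j))" using d mult_pos_pos[OF m(1), of "real J"] J by linarith
    have "- K / m * (\<Sum>j\<in>{1..J}. mix_right c (b j) (s j)) \<le> - K / m * (m * real J)"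
      using d K m(1) by (intro mult_left_mono_neg) auto
    also have "\<dots> = - K * real J" using m(1) by simp
    also note n
    finally show ?thesis using dp by (simp add: pos_le_divide_eq)
  qed
  show ?thesis
    unfolding rho1_def
  proof (rule cInf_lower)
    show "bdd_below {(\<Sum>j\<in>{1..J}. mix_right u (a j) (r j)) / (\<Sum>j\<in>{1..J}. mix_right c (a j) (r j)) | J a r.
            1 \<le> (J::nat) \<and> (\<forall>j\<in>{1..J}. r j \<in> prob_simplex) \<and>
            (1 / real J) *\<^sub>R (\<Sum>j\<in>{1..J}. r j) = q \<and>
            (\<forall>j\<in>{1..J}. a j \<in> best_pure u c (r j))}"
      by (rule bdd_belowI[of _ "- K / m"], elim CollectE exE conjE, simp only:, rule lower)
    have avg: "(1 / real (card I)) *\<^sub>R (\<Sum>j\<in>{1..card I}. r (e j)) = q"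
      using card q by (simp only: sums) simp
    show "(\<Sum>i\<in>I. mix_right u (a i) (r i)) / (\<Sum>i\<in>I. mix_right c (a i) (r i)) \<in>
        {(\<Sum>j\<in>{1..J}. mix_right u (a j) (r j)) / (\<Sum>j\<in>{1..J}. mix_right c (a j) (r j)) | J a r.
            1 \<le> (J::nat) \<and> (\<forall>j\<in>{1..J}. r j \<in> prob_simplex) \<and>
            (1 / real J) *\<^sub>R (\<Sum>j\<in>{1..J}. r j) = q \<and>
            (\<forall>j\<in>{1..J}. a j \<in> best_pure u c (r j))}"
    proof (intro CollectI exI conjI)
      show "(\<Sum>i\<in>I. mix_right u (a i) (r i)) / (\<Sum>i\<in>I. mix_right c (a i) (r i)) =
        (\<Sum>j\<in>{1..card I}. mix_right u (a (e j)) (r (e j))) / (\<Sum>j\<in>{1..card I}. mix_right c (a (e j)) (r (e j)))"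
        by (simp only: sums)
      show "\<forall>j\<in>{1..card I}. r (e j) \<in> prob_simplex" using eI r by blast
      show "\<forall>j\<in>{1..card I}. a (e j) \<in> best_pure u c (r (e j))" using eI a by blast
    qed (rule card avg)+
  qed
qed

text \<open>Integer weights are repetitions: index \<open>i\<close> is replaced by
  \<open>n i\<close> identical copies, collected in a \<open>SIGMA\<close> set.\<close>

lemma rho1_le_weighted:
  fixes u c :: "'a::finite \<Rightarrow> 'z::finite \<Rightarrow> real" and n :: "'i \<Rightarrow> nat"
  assumes c: "\<forall>x y. 0 < c x y" and fin: "finite I" and pos: "0 < (\<Sum>i\<in>I. n i)"
    and r: "\<And>i. i \<in> I \<Longrightarrow> r i \<in> prob_simplex" and a: "\<And>i. i \<in> I \<Longrightarrow> a i \<in> best_pure u c (r i)"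
    and q: "(\<Sum>i\<in>I. real (n i) *\<^sub>R r i) = real (\<Sum>i\<in>I. n i) *\<^sub>R q"
  shows "rho1 u c q \<le>
    (\<Sum>i\<in>I. real (n i) * mix_right u (a i) (r i)) / (\<Sum>i\<in>I. real (n i) * mix_right c (a i) (r i))"
proof -
  let ?I = "SIGMA i:I. {..<n i}"
  have card: "card ?I = (\<Sum>i\<in>I. n i)" using fin by (simp add: card_SigmaI)
  have sum: "(\<Sum>x\<in>?I. g (fst x)) = (\<Sum>i\<in>I. real (n i) *\<^sub>R g i)" for g :: "'i \<Rightarrow> 'b::real_vector"
  proof -
    have "(\<Sum>x\<in>?I. g (fst x)) = (\<Sum>i\<in>I. \<Sum>k\<in>{..<n i}. g i)"
      using fin by (subst sum.Sigma) (auto simp: split_beta)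
    then show ?thesis by (simp only: sum_constant_scaleR card_lessThan)
  qed
  have "rho1 u c q \<le> (\<Sum>x\<in>?I. mix_right u (a (fst x)) (r (fst x))) / (\<Sum>x\<in>?I. mix_right c (a (fst x)) (r (fst x)))"
  proof (rule rho1_le[OF c])
    show "?I \<noteq> {}"
    proof
      assume "?I = {}"
      then have "card ?I = 0" by (simp only: card.empty)
      then show False using pos unfolding card by (rule less_not_refl2[THEN notE, rotated])
    qed
    show "(\<Sum>x\<in>?I. r (fst x)) = real (card ?I) *\<^sub>R q" by (simp only: sum[of r] card q)
  qed (use fin r a in auto)
  then show ?thesis by (simp only: sum[of "\<lambda>i. mix_right u (a i) (r i)"] sum[of "\<lambda>i. mix_right c (a i) (r i)"] real_scaleR_def)
qed

text \<open>Compactness applied to the neighbourhoods \<open>U f\<close>. A multiplicative lower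
  bound, unlike closeness in norm, leaves a nonnegative remainder
  \<open>q - (1 - \<eta>) f\<close>.\<close>

lemma finite_multiplicative_cover:
  fixes Q :: "(real ^ 'n) set"
  assumes "compact Q" "0 < \<eta>" "Q \<subseteq> prob_simplex"
  obtains F where "finite F" "F \<subseteq> Q" "\<And>q. q \<in> Q \<Longrightarrow> \<exists>f\<in>F. \<forall>i. (1 - \<eta>) * f $ i \<le> q $ i"
proof -
  \<comment> \<open>The strict inequalities make \<open>U f\<close> open; they are imposed only on
    the support of \<open>f\<close>, since at a zero coordinate \<open>f\<close> itself would
    violate them.\<close>
  define U where "U f = (\<Inter>i\<in>{i. 0 < f $ i}. {q. (1 - \<eta>) * f $ i < q $ i})" for f :: "real ^ 'n"
  have "open (U f)" for f
    unfolding U_def by (rule open_INT) (auto intro!: open_Collect_less continuous_on_const continuous_on_component continuous_on_id)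
  moreover have "f \<in> U f" for f
    using \<open>0 < \<eta>\<close> by (simp add: U_def)
  ultimately obtain F where F: "F \<subseteq> Q" "finite F" "Q \<subseteq> (\<Union>f\<in>F. U f)"
    using compactE_image[OF assms(1), of Q U] by (metis UN_iff subsetI)
  show ?thesis
  proof (rule that[of F])
    fix q assume "q \<in> Q"
    then obtain f where f: "f \<in> F" "q \<in> U f" using F by auto
    have "(1 - \<eta>) * f $ i \<le> q $ i" for i
    proof (cases "0 < f $ i")
      case True then show ?thesis using f(2) by (auto simp: U_def intro: less_imp_le)
    next
      case False
      moreover have "f \<in> prob_simplex" "q \<in> prob_simplex"
        using f(1) F(1) \<open>q \<in> Q\<close> assms(3) by auto
      ultimately show ?thesis using prob_simplexD(1)[of f i] prob_simplexD(1)[of q i] by simp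
    qed
    then show "\<exists>f\<in>F. \<forall>i. (1 - \<eta>) * f $ i \<le> q $ i" using f(1) by blast
  qed (use F in auto)
qed

subsection \<open>Stability of the benchmark\<close>

text \<open>The indices in question fill at most \<open>card F\<close> fibres of
  \<open>\<phi>\<close>, each with fewer than \<open>t\<close> elements.\<close>

lemma card_small_classes:
  fixes \<phi> :: "nat \<Rightarrow> 'b"
  assumes "finite F" "\<And>j. j < J \<Longrightarrow> \<phi> j \<in> F" "0 \<le> t"
  shows "real (card {j. j < J \<and> real (card {i. i < J \<and> \<phi> i = \<phi> j}) < t}) \<le> t * real (card F)"
proof -
  let ?N = "\<lambda>f. {i. i < J \<and> \<phi> i = f}"
  let ?G = "{f \<in> F. real (card (?N f)) < t}"
  have "{j. j < J \<and> real (card (?N (\<phi> j))) < t} = (\<Union>f\<in>?G. ?N f)"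
    using assms(2) by auto
  then have "card {j. j < J \<and> real (card (?N (\<phi> j))) < t} \<le> (\<Sum>f\<in>?G. card (?N f))"
    using card_UN_le[of ?G ?N] assms(1) by simp
  then have "real (card {j. j < J \<and> real (card (?N (\<phi> j))) < t}) \<le> (\<Sum>f\<in>?G. real (card (?N f)))"
    by (simp only: of_nat_le_iff flip: of_nat_sum)
  also have "\<dots> \<le> (\<Sum>f\<in>?G. t)" by (intro sum_mono) auto
  also have "\<dots> = real (card ?G) * t" by simp
  also have "\<dots> \<le> real (card F) * t"
    using assms by (intro mult_right_mono) (auto intro: card_mono)
  finally show ?thesis by (simp add: mult.commute)
qed

text \<open>The vector \<open>q - (1 - \<eta>) f\<close> is nonnegative with total mass
  \<open>\<eta>\<close>, so \<open>w\<close> integrates against it to at least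
  \<open>- K * \<eta>\<close>; rescaling \<open>(1 - \<eta>) f\<close> to \<open>f\<close> costs
  another \<open>K * \<eta>\<close>.\<close>

lemma mix_right_diff_le:
  fixes w :: "'a::finite \<Rightarrow> 'z::finite \<Rightarrow> real"
  assumes "f \<in> prob_simplex" "q \<in> prob_simplex" "\<forall>i. (1 - \<eta>) * f $ i \<le> q $ i"
    and K: "\<forall>x y. - K \<le> w x y" "\<forall>x y. w x y \<le> K" and "0 \<le> \<eta>"
  shows "mix_right w a f \<le> mix_right w a q + 2 * K * \<eta>"
proof -
  have "(\<Sum>i\<in>UNIV. (q $ i - (1 - \<eta>) * f $ i) * (- K)) \<le> (\<Sum>i\<in>UNIV. (q $ i - (1 - \<eta>) * f $ i) * w a i)"
    using assms(3) K(1) by (intro sum_mono mult_left_mono) auto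
  also have "(\<Sum>i\<in>UNIV. (q $ i - (1 - \<eta>) * f $ i) * (- K)) = - K * ((\<Sum>i\<in>UNIV. q $ i) - (1 - \<eta>) * (\<Sum>i\<in>UNIV. f $ i))"
    by (simp add: sum_subtractf sum_distrib_left sum_distrib_right algebra_simps sum_negf sum.distrib)
  also have "\<dots> = - K * \<eta>" using assms(1,2) by (simp add: prob_simplex_def)
  also have "(\<Sum>i\<in>UNIV. (q $ i - (1 - \<eta>) * f $ i) * w a i) = mix_right w a q - (1 - \<eta>) * mix_right w a f"
    by (simp add: mix_right_def sum_subtractf sum_distrib_left algebra_simps sum.distrib)
  finally have "(1 - \<eta>) * mix_right w a f \<le> mix_right w a q + K * \<eta>" by simp
  moreover have "\<eta> * mix_right w a f \<le> \<eta> * K"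
    using mix_right_bounds(2)[OF assms(1) K] \<open>0 \<le> \<eta>\<close> by (intro mult_left_mono) auto
  ultimately show ?thesis by (simp add: algebra_simps)
qed

text \<open>
  Take \<open>m - 1\<close> copies of each \<open>f j\<close>; by \<open>dom\<close> the remainder \<open>m J q - (m - 1) \<Sum> f j\<close> is nonnegative,
  so it can be spread over equal copies of one further point of the simplex. Working with integer
  multiplicities keeps the mean exactly \<open>q\<close>.
\<close>

lemma rho1_le_of_subselection:
  fixes u c :: "'a::finite \<Rightarrow> 'z::finite \<Rightarrow> real"
  assumes c: "\<forall>x y. 0 < c x y" and cm: "\<forall>x y. cm \<le> c x y"
    and K: "\<forall>x y. u x y - \<rho> * c x y \<le> K" and \<epsilon>: "0 \<le> \<epsilon>"
    and q: "q \<in> prob_simplex" and J: "0 < J" and S: "S \<subseteq> {..<J}" and m: "0 < m"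
    and f: "\<And>j. j \<in> S \<Longrightarrow> f j \<in> prob_simplex" "\<And>j. j \<in> S \<Longrightarrow> b j \<in> best_pure u c (f j)"
    and dom: "\<And>i. (real m - 1) * (\<Sum>j\<in>S. f j $ i) \<le> real m * real J * q $ i"
    and small: "(real m - 1) * (\<Sum>j\<in>S. mix_right u (b j) (f j) - \<rho> * mix_right c (b j) (f j))
        + (real m * real J - (real m - 1) * real (card S)) * K \<le> \<epsilon> * cm * (real m * real J)"
  shows "rho1 u c q \<le> \<rho> + \<epsilon>"
proof -
  have finS: "finite S" using S finite_subset by blast
  have JS: "J \<notin> S" using S by auto
  have cardS: "card S \<le> J" using card_mono[OF _ S] by simp
  \<comment> \<open>\<open>R\<close> is the total mass of the remainder, hence the number of copies
    of the leftover point \<open>r\<close>. It is positive because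
    \<open>(m - 1) * card S < m * J\<close>.\<close>
  define R where "R = m * J - (m - 1) * card S"
  have "(m - 1) * card S \<le> (m - 1) * J" using cardS by simp
  also have "\<dots> < m * J" using J m by simp
  finally have less: "(m - 1) * card S < m * J" .
  have m1: "real (m - Suc 0) = real m - 1" using m by simp
  have R: "real R = real m * real J - (real m - 1) * real (card S)"
    using less by (simp add: R_def of_nat_diff m1)
  have Rpos: "0 < real R"
    using less unfolding R_def of_nat_0_less_iff by (rule zero_less_diff[THEN iffD2])
  define r where "r = (1 / real R) *\<^sub>R ((real m * real J) *\<^sub>R q - (real m - 1) *\<^sub>R (\<Sum>j\<in>S. f j))"
  have r: "r \<in> prob_simplex"
  proof -
    have "(\<Sum>i\<in>UNIV. (real m * real J) * q $ i - (real m - 1) * (\<Sum>j\<in>S. f j $ i)) =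
       (real m * real J) * (\<Sum>i\<in>UNIV. q $ i) - (real m - 1) * (\<Sum>j\<in>S. \<Sum>i\<in>UNIV. f j $ i)"
      by (subst sum.swap) (simp add: sum_subtractf sum_distrib_left)
    also have "\<dots> = real R" using q f(1) by (simp add: R prob_simplex_def)
    finally have "(\<Sum>i\<in>UNIV. r $ i) = 1"
      using Rpos by (simp add: r_def flip: sum_divide_distrib)
    then show ?thesis using dom Rpos by (simp add: prob_simplex_def r_def)
  qed
  obtain d where d: "d \<in> best_pure u c r" using best_pure_nonempty by blast
  \<comment> \<open>The index \<open>J\<close>, which lies outside \<open>S\<close>, carries the
    leftover point \<open>r\<close>.\<close>
  define n where "n j = (if j \<in> S then m - 1 else R)" for j
  define g where "g j = (if j \<in> S then f j else r)" for j
  define e where "e j = (if j \<in> S then b j else d)" for j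
  have split: "(\<Sum>j\<in>insert J S. real (n j) *\<^sub>R h (e j) (g j)) =
      (real m - 1) *\<^sub>R (\<Sum>j\<in>S. h (b j) (f j)) + real R *\<^sub>R h d r" for h :: "'a \<Rightarrow> real ^ 'z \<Rightarrow> 'v::real_vector"
    using JS finS by (simp add: n_def g_def e_def m1 scaleR_sum_right add.commute)
  have "(\<Sum>j\<in>insert J S. n j) = (m - 1) * card S + R"
    using JS finS by (simp add: n_def)
  also have "\<dots> = m * J" using less by (simp add: R_def)
  finally have n: "(\<Sum>j\<in>insert J S. n j) = m * J" .
  let ?U = "\<Sum>j\<in>insert J S. real (n j) * mix_right u (e j) (g j)"
  let ?C = "\<Sum>j\<in>insert J S. real (n j) * mix_right c (e j) (g j)"
  have g: "g j \<in> prob_simplex" "e j \<in> best_pure u c (g j)" if "j \<in> insert J S" for j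
    using that f r d by (auto simp: g_def e_def)
  have le: "rho1 u c q \<le> ?U / ?C"
  proof (rule rho1_le_weighted[OF c])
    show "0 < (\<Sum>j\<in>insert J S. n j)" using n J m by simp
    show "(\<Sum>j\<in>insert J S. real (n j) *\<^sub>R g j) = real (\<Sum>j\<in>insert J S. n j) *\<^sub>R q"
      unfolding n split[of "\<lambda>_ x. x"] using Rpos by (simp add: r_def)
  qed (use finS g in auto)
  obtain C where C: "\<forall>x y. c x y \<le> C" using bounded_payoff[of c] by metis
  have "cm * (real m * real J) = (\<Sum>j\<in>insert J S. real (n j) * cm)"
    by (simp only: sum_distrib_right[symmetric] of_nat_sum[symmetric] n) simp
  also have "\<dots> \<le> ?C"
    using mix_right_bounds(1)[OF g(1) cm C] by (intro sum_mono mult_left_mono) auto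
  finally have lower: "cm * (real m * real J) \<le> ?C" .
  have "0 < ?C"
  proof (rule sum_pos2[of _ J])
    show "0 < real (n J) * mix_right c (e J) (g J)"
      using mix_right_pos[OF c g(1)[of J]] JS Rpos by (simp add: n_def)
    show "0 \<le> real (n i) * mix_right c (e i) (g i)" if "i \<in> insert J S" for i
      using mix_right_pos[OF c g(1)[OF that]] by (simp add: less_imp_le)
  qed (use finS in auto)
  have w: "mix_right (\<lambda>x y. u x y - \<rho> * c x y) x s = mix_right u x s - \<rho> * mix_right c x s" for x s
    by (simp add: mix_right_def algebra_simps sum_subtractf sum_distrib_left)
  have wd: "mix_right u d r - \<rho> * mix_right c d r \<le> K"
  proof -
    obtain L where "\<forall>x y. - L \<le> u x y - \<rho> * c x y"
      using bounded_payoff[of "\<lambda>x y. u x y - \<rho> * c x y"] by metis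
    from mix_right_bounds(2)[OF r this K] show ?thesis by (simp add: w)
  qed
  \<comment> \<open>The ratio bound is equivalent to
    \<open>?U - \<rho> * ?C \<le> \<epsilon> * ?C\<close>, which is linear in the decomposition. The
    leftover copies contribute at most \<open>K\<close> each, and \<open>?C\<close> is at least
    \<open>cm\<close> times the number of points.\<close>
  have "?U - \<rho> * ?C = (\<Sum>j\<in>insert J S. real (n j) *\<^sub>R (mix_right u (e j) (g j) - \<rho> * mix_right c (e j) (g j)))"
    by (simp only: real_scaleR_def right_diff_distrib sum_subtractf sum_distrib_left mult.left_commute)
  also have "\<dots> = (real m - 1) * (\<Sum>j\<in>S. mix_right u (b j) (f j) - \<rho> * mix_right c (b j) (f j))
      + real R * (mix_right u d r - \<rho> * mix_right c d r)"
    by (subst split[of "\<lambda>x y. mix_right u x y - \<rho> * mix_right c x y"]) simp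
  also have "\<dots> \<le> (real m - 1) * (\<Sum>j\<in>S. mix_right u (b j) (f j) - \<rho> * mix_right c (b j) (f j)) + real R * K"
    using wd Rpos by (intro add_left_mono mult_left_mono) auto
  also have "\<dots> \<le> \<epsilon> * (cm * (real m * real J))" using small by (simp add: R mult.assoc)
  also have "\<dots> \<le> \<epsilon> * ?C" using lower \<epsilon> by (rule mult_left_mono)
  finally have "?U / ?C \<le> \<rho> + \<epsilon>"
    using \<open>0 < ?C\<close> by (simp add: pos_divide_le_eq algebra_simps)
  with le show ?thesis by simp
qed


lemma finite_positive_coordinates_bound:
  fixes G :: "('a \<times> (real ^ 'n)) set"
  assumes "finite G"
  obtains \<kappa> where "0 < \<kappa>" "\<forall>a f i. (a, f) \<in> G \<longrightarrow> 0 < f $ i \<longrightarrow> \<kappa> \<le> f $ i"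
proof
  let ?P = "{x \<in> (\<lambda>(g, i). snd g $ i) ` (G \<times> UNIV). 0 < x}"
  \<comment> \<open>Inserting 1 keeps the minimum defined when no coordinate is positive.\<close>
  have fin: "finite (insert 1 ?P)" using assms by simp
  show "0 < Min (insert 1 ?P)" using fin by (subst Min_gr_iff) auto
  show "\<forall>a f i. (a, f) \<in> G \<longrightarrow> 0 < f $ i \<longrightarrow> Min (insert 1 ?P) \<le> f $ i"
  proof (intro allI impI)
    fix a f i assume "(a, f) \<in> G" "0 < f $ i"
    then have "f $ i \<in> insert 1 ?P" by (auto intro!: image_eqI[of _ _ "((a, f), i)"])
    then show "Min (insert 1 ?P) \<le> f $ i" by (rule Min_le[OF fin])
  qed
qed

text \<open>
  Each \<open>r j\<close> dominates \<open>(1 - \<eta>) f j\<close> for some \<open>f j\<close> in a finite set. After dropping the indices whose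
  \<open>f j\<close> is rarely used, every coordinate occurring in a remaining \<open>f j\<close> has average bounded away from
  \<open>0\<close>, so the additive error \<open>\<delta>\<close> becomes a multiplicative one. This makes \<open>\<delta>\<close> uniform in \<open>q\<close>, up to the
  boundary of the simplex.
\<close>

lemma rho1_le_of_near_average:
  fixes u c :: "'a::finite \<Rightarrow> 'z::finite \<Rightarrow> real"
  assumes c: "\<forall>x y. 0 < c x y" and \<epsilon>: "0 < \<epsilon>"
  obtains \<delta> where "0 < \<delta>"
    "\<And>\<rho> q J r b. \<bar>\<rho>\<bar> \<le> B \<Longrightarrow> q \<in> prob_simplex \<Longrightarrow> 0 < J \<Longrightarrow>
      (\<And>j. j < J \<Longrightarrow> r j \<in> prob_simplex) \<Longrightarrow> (\<And>j. j < J \<Longrightarrow> b j \<in> best_pure u c (r j)) \<Longrightarrow>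
      (\<And>i. (\<Sum>j<J. r j $ i) / real J \<le> q $ i + \<delta>) \<Longrightarrow>
      (\<Sum>j<J. mix_right u (b j) (r j) - \<rho> * mix_right c (b j) (r j)) \<le> \<delta> * real J \<Longrightarrow>
      rho1 u c q \<le> \<rho> + \<epsilon>"
proof -
  obtain cm where cm: "0 < cm" "\<forall>x y. cm \<le> c x y" using positive_payoff_bounded_below[OF c] .
  obtain C where C: "0 < C" "\<forall>x y. c x y \<le> C" using bounded_payoff[of c] by metis
  obtain L where L: "0 < L" "\<forall>x y. \<bar>u x y\<bar> \<le> L" using bounded_payoff[of u] by metis
  \<comment> \<open>Bounds \<open>u - \<rho> c\<close> for all
    \<open>\<bar>\<rho>\<bar> \<le> B\<close> at once, so that \<open>\<delta>\<close> can be chosen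
    before \<open>\<rho>\<close>.\<close>
  define K where "K = L + \<bar>B\<bar> * C"
  have K: "0 < K" using L C by (auto simp: K_def intro!: add_pos_nonneg)
  have Kb: "\<bar>u x y - \<rho> * c x y\<bar> \<le> K" if "\<bar>\<rho>\<bar> \<le> B" for \<rho> x y
  proof -
    have "\<bar>\<rho> * c x y\<bar> \<le> \<bar>B\<bar> * C"
      unfolding abs_mult using that C(2) c by (intro mult_mono) (auto simp: less_imp_le abs_of_pos)
    then show ?thesis using L(2)[rule_format, of x y] unfolding K_def by linarith
  qed
  \<comment> \<open>The error budget is \<open>\<epsilon> * cm * m * J\<close>, to be split into
    thirds. This \<open>m\<close> makes \<open>2 * K * J\<close> at most one third: one
    \<open>K * J\<close> comes from the leftover mass, the other from passing from
    \<open>r j\<close> to \<open>f j\<close>.\<close>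
  obtain m :: nat where m': "6 * K / (\<epsilon> * cm) \<le> real m" using real_arch_simple by blast
  have "0 < 6 * K / (\<epsilon> * cm)" using K \<epsilon> cm by simp
  with m' have "0 < real m" by (rule less_le_trans[rotated])
  then have m: "0 < m" "6 * K \<le> \<epsilon> * cm * real m"
    using m' \<epsilon> cm by (simp_all add: pos_divide_le_eq mult.commute)
  \<comment> \<open>Chosen so that \<open>m * (1 - \<eta>)^2 \<ge> m - 1\<close>: one factor
    \<open>1 - \<eta>\<close> pays for the domination of \<open>f j\<close> by \<open>r j\<close>,
    the other for the additive error \<open>\<delta>\<close>.\<close>
  define \<eta> where "\<eta> = 1 / (2 * real m)"
  have \<eta>: "0 < \<eta>" "\<eta> < 1" "2 * \<eta> * real m = 1" using m(1) by (auto simp: \<eta>_def)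
  have "\<exists>F. finite F \<and> F \<subseteq> {q \<in> prob_simplex. a \<in> best_pure u c q} \<and>
      (\<forall>q\<in>{q \<in> prob_simplex. a \<in> best_pure u c q}. \<exists>f\<in>F. \<forall>i. (1 - \<eta>) * f $ i \<le> q $ i)" for a
    by (rule finite_multiplicative_cover[OF compact_best_pure_region[OF c, of a u] \<eta>(1)]) auto
  then have "\<exists>F. \<forall>a. finite (F a) \<and> F a \<subseteq> {q \<in> prob_simplex. a \<in> best_pure u c q} \<and>
      (\<forall>q\<in>{q \<in> prob_simplex. a \<in> best_pure u c q}. \<exists>f\<in>F a. \<forall>i. (1 - \<eta>) * f $ i \<le> q $ i)"
    by (intro choice allI)
  then obtain F where F: "\<And>a. finite (F a)" "\<And>a. F a \<subseteq> {q \<in> prob_simplex. a \<in> best_pure u c q}"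
    "\<And>a q. q \<in> prob_simplex \<Longrightarrow> a \<in> best_pure u c q \<Longrightarrow> \<exists>f\<in>F a. \<forall>i. (1 - \<eta>) * f $ i \<le> q $ i"
    by blast
  define G where "G = Sigma UNIV F"
  have finG: "finite G" using F(1) by (simp add: G_def)
  obtain \<kappa> where \<kappa>: "0 < \<kappa>" "\<forall>a f i. (a, f) \<in> G \<longrightarrow> 0 < f $ i \<longrightarrow> \<kappa> \<le> f $ i"
    using finite_positive_coordinates_bound[OF finG] .
  \<comment> \<open>Classes with fewer than \<open>\<theta> * J\<close> members will be dropped, at
    most \<open>\<theta> * J * card G\<close> indices in all; their cost then fits into another
    third of the budget.\<close>
  define \<theta> where "\<theta> = \<epsilon> * cm / (6 * K * (real (card G) + 1))"
  have \<theta>: "0 < \<theta>" using \<epsilon> cm K by (simp add: \<theta>_def)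
  have "6 * K * \<theta> * real (card G) \<le> 6 * K * \<theta> * (real (card G) + 1)"
    using K \<theta> by (intro mult_left_mono) auto
  also have "\<dots> = \<epsilon> * cm" using K by (simp add: \<theta>_def)
  finally have \<theta>G: "6 * K * \<theta> * real (card G) \<le> \<epsilon> * cm" .
  \<comment> \<open>The first entry is the last third of the budget. In the second,
    \<open>(1 - \<eta>) * \<theta> * \<kappa>\<close> is a lower bound for the average of every
    coordinate still in use, so \<open>\<delta>\<close> is at most the fraction
    \<open>\<eta>\<close> of that average.\<close>
  define \<delta> where "\<delta> = min (\<epsilon> * cm / 3) (\<eta> * ((1 - \<eta>) * \<theta> * \<kappa>))"
  show ?thesis
  proof (rule that)
    show "0 < \<delta>" using \<epsilon> cm \<eta> \<theta> \<kappa> by (simp add: \<delta>_def)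
  next
    fix \<rho> q J r b
    assume \<rho>: "\<bar>\<rho>\<bar> \<le> B" and q: "q \<in> prob_simplex" and J: "0 < (J::nat)"
      and r: "\<And>j. j < J \<Longrightarrow> r j \<in> prob_simplex" and b: "\<And>j. j < J \<Longrightarrow> b j \<in> best_pure u c (r j)"
      and near: "\<And>i. (\<Sum>j<J. r j $ i) / real J \<le> q $ i + \<delta>"
      and sum: "(\<Sum>j<J. mix_right u (b j) (r j) - \<rho> * mix_right c (b j) (r j)) \<le> \<delta> * real J"
    have "\<forall>j. \<exists>f. j < J \<longrightarrow> f \<in> F (b j) \<and> (\<forall>i. (1 - \<eta>) * f $ i \<le> r j $ i)"
      using F(3)[OF r b] by blast
    then obtain f where f: "\<And>j. j < J \<Longrightarrow> f j \<in> F (b j)" "\<And>j i. j < J \<Longrightarrow> (1 - \<eta>) * f j $ i \<le> r j $ i"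
      by metis
    have fS: "f j \<in> prob_simplex" "b j \<in> best_pure u c (f j)" if "j < J" for j
      using f(1)[OF that] F(2) by auto
    define \<phi> where "\<phi> j = (b j, f j)" for j
    have \<phi>: "\<phi> j \<in> G" if "j < J" for j using f(1)[OF that] by (simp add: \<phi>_def G_def)
    define T where "T = {j. j < J \<and> real (card {i. i < J \<and> \<phi> i = \<phi> j}) < \<theta> * real J}"
    define S where "S = {..<J} - T"
    have T: "T \<subseteq> {..<J}" "finite T" by (auto simp: T_def)
    have cardT: "real (card T) \<le> \<theta> * real J * real (card G)"
      unfolding T_def using \<theta> by (intro card_small_classes[OF finG \<phi>]) auto
    have cardS: "real (card S) = real J - real (card T)"
      using T card_mono[OF _ T(1)] by (simp add: S_def card_Diff_subset of_nat_diff)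
    define w where "w x s = mix_right u x s - \<rho> * mix_right c x s" for x s
    have w_eq: "w x s = mix_right (\<lambda>x y. u x y - \<rho> * c x y) x s" for x s
      by (simp add: w_def mix_right_def algebra_simps sum_subtractf sum_distrib_left)
    have wK: "\<forall>x y. - K \<le> u x y - \<rho> * c x y" "\<forall>x y. u x y - \<rho> * c x y \<le> K"
      using Kb[OF \<rho>] by (simp_all add: abs_le_iff) (metis minus_le_iff minus_diff_eq)
    have dom: "(real m - 1) * (\<Sum>j\<in>S. f j $ i) \<le> real m * real J * q $ i" for i
    proof (cases "\<exists>j\<in>S. 0 < f j $ i")
      case False
      then have "f j $ i = 0" if "j \<in> S" for j
        using that fS(1)[of j] prob_simplexD(1)[of "f j" i] by (force simp: S_def)
      then show ?thesis using prob_simplexD(1)[OF q, of i] by simp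
    next
      case True
      then obtain k where k: "k \<in> S" "0 < f k $ i" by blast
      \<comment> \<open>The class of \<open>k\<close> survived, so it has at least
        \<open>\<theta> * J\<close> members, all with the same \<open>f\<close> and hence with
        \<open>i\<close>-th coordinate at least \<open>\<kappa>\<close>.\<close>
      define A where "A = {j. j < J \<and> \<phi> j = \<phi> k}"
      have A: "A \<subseteq> {..<J}" "\<theta> * real J \<le> real (card A)"
        using k(1) by (auto simp: A_def S_def T_def)
      have rnn: "0 \<le> r j $ i" if "j < J" for j using r[OF that] by (rule prob_simplexD)
      have "\<kappa> \<le> f k $ i" using \<phi>[of k] k \<kappa>(2) by (auto simp: S_def \<phi>_def)
      then have "\<theta> * real J * ((1 - \<eta>) * \<kappa>) \<le> real (card A) * ((1 - \<eta>) * f k $ i)"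
        using A(2) \<eta> \<kappa>(1) \<theta> by (intro mult_mono) auto
      also have "\<dots> = (\<Sum>j\<in>A. (1 - \<eta>) * f j $ i)" by (simp add: A_def \<phi>_def)
      also have "\<dots> \<le> (\<Sum>j\<in>A. r j $ i)" using f(2) by (intro sum_mono) (auto simp: A_def)
      also have "\<dots> \<le> (\<Sum>j<J. r j $ i)" using A(1) rnn by (intro sum_mono2) auto
      finally have "(1 - \<eta>) * \<theta> * \<kappa> \<le> (\<Sum>j<J. r j $ i) / real J"
        using J by (simp add: pos_le_divide_eq mult_ac)
      then have "\<eta> * ((1 - \<eta>) * \<theta> * \<kappa>) \<le> \<eta> * ((\<Sum>j<J. r j $ i) / real J)"
        using \<eta>(1) by (intro mult_left_mono) auto
      then have "\<delta> \<le> \<eta> * ((\<Sum>j<J. r j $ i) / real J)" by (simp add: \<delta>_def)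
      then have "(1 - \<eta>) * ((\<Sum>j<J. r j $ i) / real J) \<le> q $ i"
        using near[of i] unfolding left_diff_distrib by linarith
      then have le: "(1 - \<eta>) * (\<Sum>j<J. r j $ i) \<le> real J * q $ i"
        using J by (simp add: field_simps)
      have "(1 - \<eta>) * (\<Sum>j\<in>S. f j $ i) = (\<Sum>j\<in>S. (1 - \<eta>) * f j $ i)" by (simp add: sum_distrib_left)
      also have "\<dots> \<le> (\<Sum>j\<in>S. r j $ i)" using f(2) by (intro sum_mono) (auto simp: S_def)
      also have "\<dots> \<le> (\<Sum>j<J. r j $ i)" using rnn by (intro sum_mono2) (auto simp: S_def)
      finally have "(1 - \<eta>) * ((1 - \<eta>) * (\<Sum>j\<in>S. f j $ i)) \<le> (1 - \<eta>) * (\<Sum>j<J. r j $ i)"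
        using \<eta> by (intro mult_left_mono) auto
      with le have "(1 - \<eta>) * (1 - \<eta>) * (\<Sum>j\<in>S. f j $ i) \<le> real J * q $ i" by simp
      then have le2: "real m * ((1 - \<eta>) * (1 - \<eta>) * (\<Sum>j\<in>S. f j $ i)) \<le> real m * (real J * q $ i)"
        by (intro mult_left_mono) auto
      have "real m * ((1 - \<eta>) * (1 - \<eta>)) = real m - 2 * \<eta> * real m + real m * \<eta> * \<eta>"
        by (simp add: algebra_simps)
      then have "real m - 1 \<le> real m * ((1 - \<eta>) * (1 - \<eta>))" using \<eta> by simp
      then have "(real m - 1) * (\<Sum>j\<in>S. f j $ i) \<le> real m * ((1 - \<eta>) * (1 - \<eta>)) * (\<Sum>j\<in>S. f j $ i)"
        using fS(1) by (intro mult_right_mono sum_nonneg prob_simplexD(1)) (auto simp: S_def)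
      with le2 show ?thesis by (simp add: mult.assoc)
    qed
    have small: "(real m - 1) * (\<Sum>j\<in>S. w (b j) (f j)) + (real m * real J - (real m - 1) * real (card S)) * K
        \<le> \<epsilon> * cm * (real m * real J)"
    proof -
      have "(\<Sum>j\<in>S. w (b j) (f j)) \<le> (\<Sum>j\<in>S. w (b j) (r j) + 2 * K * \<eta>)"
        unfolding w_eq using f(2) fS(1) r \<eta>(1) by (intro sum_mono mix_right_diff_le wK) (auto simp: S_def)
      also have "\<dots> = (\<Sum>j\<in>S. w (b j) (r j)) + real (card S) * (2 * K * \<eta>)" by (simp add: sum.distrib)
      finally have wS: "(\<Sum>j\<in>S. w (b j) (f j)) \<le> (\<Sum>j\<in>S. w (b j) (r j)) + real (card S) * (2 * K * \<eta>)" .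
      have "(\<Sum>j\<in>S. w (b j) (r j)) = (\<Sum>j<J. w (b j) (r j)) - (\<Sum>j\<in>T. w (b j) (r j))"
        unfolding S_def using T by (simp add: sum_diff)
      \<comment> \<open>Dropped indices may have had negative payoff; removing one raises the sum by
        at most \<open>K\<close>.\<close>
      moreover have "- (\<Sum>j\<in>T. w (b j) (r j)) \<le> real (card T) * K"
      proof -
        have "(\<Sum>j\<in>T. - K) \<le> (\<Sum>j\<in>T. w (b j) (r j))"
          unfolding w_eq using r by (intro sum_mono mix_right_bounds(1)[OF _ wK]) (auto simp: T_def)
        then show ?thesis by simp
      qed
      moreover have "(\<Sum>j<J. w (b j) (r j)) \<le> \<epsilon> * cm / 3 * real J"
      proof -
        have "\<delta> * real J \<le> \<epsilon> * cm / 3 * real J" by (intro mult_right_mono) (auto simp: \<delta>_def)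
        with sum show ?thesis by (simp add: w_def)
      qed
      moreover have "real (card S) * (2 * K * \<eta>) \<le> real J * (2 * K * \<eta>)"
        using cardS K \<eta> by (intro mult_right_mono) auto
      ultimately have "(\<Sum>j\<in>S. w (b j) (f j)) \<le> \<epsilon> * cm / 3 * real J + real (card T) * K + real J * (2 * K * \<eta>)"
        using wS by linarith
      then have "(real m - 1) * (\<Sum>j\<in>S. w (b j) (f j)) \<le>
          (real m - 1) * (\<epsilon> * cm / 3 * real J + real (card T) * K + real J * (2 * K * \<eta>))"
        using m(1) by (intro mult_left_mono) auto
      also have "\<dots> \<le> real m * (\<epsilon> * cm / 3 * real J + real (card T) * K + real J * (2 * K * \<eta>)) - real (card T) * K"
        using \<epsilon> cm(1) K \<eta>(1) by (simp add: algebra_simps)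
      finally have 1: "(real m - 1) * (\<Sum>j\<in>S. w (b j) (f j)) \<le>
          real m * real J * (\<epsilon> * cm) / 3 + real m * real (card T) * K + real J * K * (2 * \<eta> * real m) - real (card T) * K"
        by (simp add: algebra_simps)
      have "2 * (real m * K) * real (card T) \<le> 2 * (real m * K) * (\<theta> * real J * real (card G))"
        using cardT K by (intro mult_left_mono) auto
      also have "\<dots> = real m * real J * (6 * K * \<theta> * real (card G)) / 3" by simp
      also have "\<dots> \<le> real m * real J * (\<epsilon> * cm) / 3"
        using \<theta>G by (intro divide_right_mono mult_left_mono) auto
      finally have 2: "2 * (real m * K) * real (card T) \<le> real m * real J * (\<epsilon> * cm) / 3" .
      have "real J * (6 * K) \<le> real J * (\<epsilon> * cm * real m)"
        using m(2) by (intro mult_left_mono) auto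
      then have 3: "2 * K * real J \<le> real m * real J * (\<epsilon> * cm) / 3" by (simp add: mult_ac)
      have 4: "0 \<le> real (card T) * K" using K by simp
      have "(real m * real J - (real m - 1) * real (card S)) * K = real J * K + real m * real (card T) * K - real (card T) * K"
        by (simp add: cardS algebra_simps)
      with 1 2 3 4 show ?thesis unfolding \<eta>(3) by (simp add: algebra_simps)
    qed
    show "rho1 u c q \<le> \<rho> + \<epsilon>"
    proof (rule rho1_le_of_subselection[OF c cm(2) wK(2) _ q J _ m(1)])
      show "S \<subseteq> {..<J}" by (auto simp: S_def)
    qed (use \<epsilon> fS dom small in \<open>auto simp: S_def w_def\<close>)
  qed
qed

subsection \<open>Matrix games and approachability\<close>

text \<open>The hard half of the minimax theorem, by separation: the convex set \<open>D\<close> of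
  payoff vectors misses the open orthant \<open>E\<close> below \<open>v\<close>. The normal of a
  separating hyperplane is nonnegative and, normalized, is the required mixed action.\<close>

lemma matrix_game_guarantee:
  fixes g :: "'a::finite \<Rightarrow> 'z::finite \<Rightarrow> real"
  assumes "\<And>q. q \<in> prob_simplex \<Longrightarrow> \<exists>a. v \<le> mix_right g a q"
  obtains p where "p \<in> prob_simplex" "\<And>z. v \<le> (\<Sum>a\<in>UNIV. p $ a * g a z)"
proof -
  define D where "D = (\<lambda>q. \<chi> a. mix_right g a q) ` prob_simplex"
  define E where "E = {y :: real ^ 'a. \<forall>a. y $ a < v}"
  have "linear (\<lambda>q. \<chi> a. mix_right g a q)"
    by (rule linearI) (simp_all add: vec_eq_iff mix_right_def algebra_simps sum.distrib sum_distrib_left)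
  then have "convex D" unfolding D_def by (rule convex_linear_image) (rule convex_prob_simplex)
  moreover have "convex E"
    unfolding E_def by (auto simp: convex_def intro!: convex_bound_lt)
  moreover have "E \<inter> D = {}"
    using assms by (force simp: D_def E_def not_less[symmetric])
  moreover have "(\<chi> a. v - 1) \<in> E" by (simp add: E_def)
  moreover have "D \<noteq> {}" using axis_in_prob_simplex by (auto simp: D_def)
  ultimately obtain n \<beta> where n: "n \<noteq> 0" and E: "\<And>y. y \<in> E \<Longrightarrow> n \<bullet> y \<le> \<beta>" and D: "\<And>y. y \<in> D \<Longrightarrow> \<beta> \<le> n \<bullet> y"
    using separating_hyperplane_sets[of E D] by blast
  have nn: "0 \<le> n $ a" for a
  proof (rule ccontr)
    assume neg: "\<not> 0 \<le> n $ a"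
    define y where "y t = (\<chi> i. v - 1) - t *\<^sub>R (axis a 1 :: real ^ 'a)" for t
    \<comment> \<open>Moving down along a coordinate with negative normal stays inside
      \<open>E\<close> and increases the functional; this \<open>t\<close> pushes it to at least
      \<open>\<beta> + 1\<close>.\<close>
    define t where "t = max 0 ((\<beta> - n \<bullet> (\<chi> i. v - 1) + 1) / (- n $ a))"
    have "y t \<in> E" by (auto simp: E_def y_def axis_def t_def)
    then have "n \<bullet> (\<chi> i. v - 1) - t * n $ a \<le> \<beta>"
      using E[of "y t"] by (simp add: y_def inner_diff_right inner_axis)
    moreover have "(\<beta> - n \<bullet> (\<chi> i. v - 1) + 1) / (- n $ a) \<le> t" by (simp add: t_def)
    then have "\<beta> - n \<bullet> (\<chi> i. v - 1) + 1 \<le> t * (- n $ a)"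
      using neg by (subst (asm) pos_divide_le_eq) auto
    ultimately show False by simp
  qed
  define s where "s = (\<Sum>a\<in>UNIV. n $ a)"
  have "s \<noteq> 0"
    using n nn unfolding s_def by (subst sum_nonneg_eq_0_iff) (auto simp: vec_eq_iff)
  moreover have "0 \<le> s" unfolding s_def using nn by (intro sum_nonneg) auto
  ultimately have s: "0 < s" by simp
  \<comment> \<open>The constant vector \<open>v\<close> lies only on the boundary of
    \<open>E\<close>, so it is approached by \<open>v - e\<close>.\<close>
  have "v \<le> \<beta> / s"
  proof (rule field_le_epsilon)
    fix e :: real assume "0 < e"
    then have "n \<bullet> (\<chi> a. v - e) \<le> \<beta>" by (intro E) (simp add: E_def)
    also have "n \<bullet> (\<chi> a. v - e) = s * (v - e)" by (simp add: inner_vec_def s_def sum_distrib_right)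
    finally show "v \<le> \<beta> / s + e" using s by (simp add: field_simps)
  qed
  show ?thesis
  proof (rule that[of "(1 / s) *\<^sub>R n"])
    show "(1 / s) *\<^sub>R n \<in> prob_simplex"
      using s nn by (simp add: prob_simplex_def flip: sum_divide_distrib s_def)
    fix z
    have "(\<chi> a. mix_right g a (axis z 1)) \<in> D" using axis_in_prob_simplex by (auto simp: D_def)
    moreover have "mix_right g a (axis z 1) = g a z" for a
    proof -
      have "mix_right g a (axis z 1) = (\<Sum>i\<in>UNIV. if i = z then g a i else 0)"
        unfolding mix_right_def by (intro sum.cong) (auto simp: axis_def)
      then show ?thesis by simp
    qed
    ultimately have "\<beta> \<le> (\<Sum>a\<in>UNIV. n $ a * g a z)"
      using D[of "\<chi> a. mix_right g a (axis z 1)"] by (simp add: inner_vec_def)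
    then have "\<beta> / s \<le> (\<Sum>a\<in>UNIV. n $ a * g a z) / s" using s by (intro divide_right_mono) auto
    with \<open>v \<le> \<beta> / s\<close> show "v \<le> (\<Sum>a\<in>UNIV. ((1 / s) *\<^sub>R n) $ a * g a z)"
      by (simp add: sum_divide_distrib)
  qed
qed

lemma mix_matrix_game:
  "mix g p q = (\<Sum>z\<in>UNIV. q $ z * (\<Sum>a\<in>UNIV. p $ a * g a z))" for g :: "'a::finite \<Rightarrow> 'z::finite \<Rightarrow> real"
  unfolding mix_def by (subst sum.swap) (simp add: sum_distrib_left mult_ac)

text \<open>Both sides are compared with the value \<open>v\<close> of the game: the minimizer
  \<open>q\<close> concedes at most \<open>v\<close>, and the maximizer \<open>p\<close> secures at
  least \<open>v\<close> because some mixed action does.\<close>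

lemma saddle_point_inequality:
  fixes g :: "'a::finite \<Rightarrow> 'z::finite \<Rightarrow> real"
  assumes p: "is_arg_max (\<lambda>p. INF q\<in>prob_simplex. mix g p q) (\<lambda>p. p \<in> prob_simplex) p"
    and q: "is_arg_min (\<lambda>q. SUP p\<in>prob_simplex. mix g p q) (\<lambda>q. q \<in> prob_simplex) q"
    and p': "p' \<in> prob_simplex" and q': "q' \<in> prob_simplex"
  shows "mix g p' q \<le> mix g p q'"
proof -
  obtain K where K: "\<forall>a z. - K \<le> g a z" "\<forall>a z. g a z \<le> K" using bounded_payoff[of g] by metis
  have bdd: "bdd_above ((\<lambda>p. mix g p q) ` prob_simplex)" if "q \<in> prob_simplex" for q
    using mix_bounds(2)[OF _ that K] by (intro bdd_aboveI2[where M = K])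
  have bdd': "bdd_below (mix g p ` prob_simplex)" if "p \<in> prob_simplex" for p
    using mix_bounds(1)[OF that _ K] by (intro bdd_belowI2[where m = "- K"])
  have pS: "p \<in> prob_simplex" and qS: "q \<in> prob_simplex" using p q by (auto simp: is_arg_max_def is_arg_min_def)
  have ne: "prob_simplex \<noteq> ({} :: (real ^ 'a) set)" "prob_simplex \<noteq> ({} :: (real ^ 'z) set)"
    using axis_in_prob_simplex by auto
  define v where "v = (SUP p\<in>prob_simplex. mix g p q)"
  \<comment> \<open>Otherwise all actions earn less than \<open>v\<close> against \<open>r\<close>,
    and \<open>r\<close> would beat the minimizer \<open>q\<close>.\<close>
  have "\<exists>a. v \<le> mix_right g a r" if r: "r \<in> prob_simplex" for r
  proof (rule ccontr)
    assume "\<not> ?thesis"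
    then have less: "Max (range (\<lambda>a. mix_right g a r)) < v" by (subst Max_less_iff) (auto simp: not_le)
    have "mix g p r \<le> Max (range (\<lambda>a. mix_right g a r))" if "p \<in> prob_simplex" for p
      using simplex_average_bounds(2)[OF that, of "- K" "\<lambda>a. mix_right g a r"] mix_right_bounds(1)[OF r K]
      by (simp add: mix_eq_mix_right)
    then have "(SUP p\<in>prob_simplex. mix g p r) \<le> Max (range (\<lambda>a. mix_right g a r))"
      using ne by (intro cSUP_least) auto
    moreover have "v \<le> (SUP p\<in>prob_simplex. mix g p r)"
      using q r by (auto simp: is_arg_min_def v_def not_less)
    ultimately show False using less by linarith
  qed
  then obtain s where s: "s \<in> prob_simplex" "\<And>z. v \<le> (\<Sum>a\<in>UNIV. s $ a * g a z)"
    using matrix_game_guarantee by metis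
  have "v \<le> mix g s r" if "r \<in> prob_simplex" for r
  proof -
    have "v = (\<Sum>z\<in>UNIV. r $ z * v)" using that by (simp add: prob_simplex_def flip: sum_distrib_right)
    also have "\<dots> \<le> mix g s r"
      unfolding mix_matrix_game using s(2) that by (intro sum_mono mult_left_mono prob_simplexD) auto
    finally show ?thesis .
  qed
  then have "v \<le> (INF r\<in>prob_simplex. mix g s r)" using ne by (intro cINF_greatest) auto
  also have "\<dots> \<le> (INF r\<in>prob_simplex. mix g p r)"
    using p s(1) by (auto simp: is_arg_max_def not_less)
  also have "\<dots> \<le> mix g p q'" using bdd'[OF pS] q' by (rule cINF_lower)
  finally have "v \<le> mix g p q'" .
  moreover have "mix g p' q \<le> v" unfolding v_def using bdd[OF qS] p' by (intro cSUP_upper)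
  ultimately show ?thesis by simp
qed

section \<open>The auxiliary game and Blackwell's condition\<close>

text \<open>Since \<open>p\<close> has total mass 1, the term linear in \<open>q\<close> can be
  absorbed into the matrix entries, which makes the auxiliary game a matrix game.\<close>

lemma aux_payoff_eq_mix:
  assumes "p \<in> prob_simplex" "q \<in> prob_simplex"
  shows "aux_payoff u c lv lq p q = mix (\<lambda>a z. lv \<bullet> pair_payoff u c a z + lq $ z) p q"
proof -
  have "(\<Sum>a\<in>UNIV. \<Sum>z\<in>UNIV. p $ a * q $ z * lq $ z) = (\<Sum>a\<in>UNIV. p $ a) * (\<Sum>z\<in>UNIV. q $ z * lq $ z)"
    by (simp add: sum_product mult.assoc)
  also have "\<dots> = lq \<bullet> q" using assms by (simp add: prob_simplex_def inner_vec_def mult.commute)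
  finally show ?thesis
    by (simp add: aux_payoff_def mix_def inner_sum_right distrib_left sum.distrib)
qed

text \<open>Blackwell's condition for the target 0. It is the saddle point inequality with the agent
  deviating to \<open>ps (h @ [(x, y)])\<close> and the opponent to the pure action
  \<open>y\<close>, whatever \<open>y\<close> is.\<close>

lemma follows_rule_inner_le:
  assumes rule: "follows_rule u c \<sigma> qs ps vs" and "h \<noteq> []"
  shows "lambda_v u c \<sigma> vs h \<bullet> (vs (h @ [(x, y)]) - mix_left (pair_payoff u c) (\<sigma> h) y)
    + lambda_q qs h \<bullet> (qs h - axis y 1) \<le> 0"
proof -
  let ?lv = "lambda_v u c \<sigma> vs h" and ?lq = "lambda_q qs h"
  let ?g = "\<lambda>a z. ?lv \<bullet> pair_payoff u c a z + ?lq $ z"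
  let ?p' = "ps (h @ [(x, y)])"
  have p: "is_arg_max (\<lambda>p. INF q\<in>prob_simplex. aux_payoff u c ?lv ?lq p q) (\<lambda>p. p \<in> prob_simplex) (\<sigma> h)"
    and q: "is_arg_min (\<lambda>q. SUP p\<in>prob_simplex. aux_payoff u c ?lv ?lq p q) (\<lambda>q. q \<in> prob_simplex) (qs h)"
    and p': "?p' \<in> best_mixed u c (qs h)"
    and vs: "vs (h @ [(x, y)]) = (mix u ?p' (qs h), mix c ?p' (qs h))"
    using assms by (auto simp: follows_rule_def)
  have S: "\<sigma> h \<in> prob_simplex" "qs h \<in> prob_simplex" "?p' \<in> prob_simplex"
    using p q p' by (auto simp: is_arg_max_def is_arg_min_def best_mixed_def)
  have inf: "(INF q\<in>prob_simplex. aux_payoff u c ?lv ?lq p q) = (INF q\<in>prob_simplex. mix ?g p q)"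
    if "p \<in> prob_simplex" for p
    by (rule INF_cong) (auto simp: aux_payoff_eq_mix that)
  have sup: "(SUP p\<in>prob_simplex. aux_payoff u c ?lv ?lq p q) = (SUP p\<in>prob_simplex. mix ?g p q)"
    if "q \<in> prob_simplex" for q
    by (rule SUP_cong) (auto simp: aux_payoff_eq_mix that)
  have "aux_payoff u c ?lv ?lq ?p' (qs h) \<le> aux_payoff u c ?lv ?lq (\<sigma> h) (axis y 1)"
    unfolding aux_payoff_eq_mix[OF S(3,2)] aux_payoff_eq_mix[OF S(1) axis_in_prob_simplex]
  proof (rule saddle_point_inequality[OF _ _ S(3) axis_in_prob_simplex])
    show "is_arg_max (\<lambda>p. INF q\<in>prob_simplex. mix ?g p q) (\<lambda>p. p \<in> prob_simplex) (\<sigma> h)"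
      using p S(1) by (simp add: is_arg_max_def inf cong: conj_cong)
    show "is_arg_min (\<lambda>q. SUP p\<in>prob_simplex. mix ?g p q) (\<lambda>q. q \<in> prob_simplex) (qs h)"
      using q S(2) by (simp add: is_arg_min_def sup cong: conj_cong)
  qed
  moreover have "mix (pair_payoff u c) ?p' (qs h) = vs (h @ [(x, y)])"
    by (simp add: vs mix_def pair_payoff_def prod_eq_iff fst_sum snd_sum)
  moreover have "mix (pair_payoff u c) (\<sigma> h) (axis y 1) = mix_left (pair_payoff u c) (\<sigma> h) y"
  proof -
    have "mix (pair_payoff u c) (\<sigma> h) (axis y 1) =
        (\<Sum>a\<in>UNIV. \<Sum>z\<in>UNIV. if z = y then \<sigma> h $ a *\<^sub>R pair_payoff u c a z else 0)"
      unfolding mix_def by (intro sum.cong) (auto simp: axis_def)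
    then show ?thesis by (simp add: mix_left_def)
  qed
  ultimately show ?thesis by (simp add: aux_payoff_def inner_diff_right)
qed

text \<open>Expanding the square, the cross term is nonpositive, so each step adds at most
  \<open>K^2\<close>.\<close>

lemma norm_sum_le_of_inner_le:
  fixes x :: "nat \<Rightarrow> 'a::real_inner"
  assumes "\<And>n. norm (x n) \<le> K" "\<And>n. (\<Sum>k<n. x k) \<bullet> x n \<le> 0"
  shows "(norm (\<Sum>k<n. x k))\<^sup>2 \<le> real n * K\<^sup>2"
proof (induction n)
  case (Suc n)
  have "(norm (\<Sum>k<Suc n. x k))\<^sup>2 = (norm (\<Sum>k<n. x k))\<^sup>2 + 2 * ((\<Sum>k<n. x k) \<bullet> x n) + (norm (x n))\<^sup>2"
    by (simp add: power2_norm_eq_inner inner_add_left inner_add_right inner_commute)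
  also have "\<dots> \<le> real n * K\<^sup>2 + 0 + K\<^sup>2"
    using Suc.IH assms(2)[of n] assms(1)[of n] by (intro add_mono power_mono) auto
  finally show ?case by (simp add: algebra_simps)
qed simp

lemma average_tendsto_0_of_inner_le:
  fixes x :: "nat \<Rightarrow> 'a::real_inner"
  assumes "\<And>n. norm (x n) \<le> K" "\<And>n. (\<Sum>k<n. x k) \<bullet> x n \<le> 0"
  shows "(\<lambda>n. (1 / real n) *\<^sub>R (\<Sum>k<n. x k)) \<longlonglongrightarrow> 0"
proof (rule Lim_null_comparison)
  have K: "0 \<le> K" using norm_ge_zero assms(1) by (rule order_trans)
  show "\<forall>\<^sub>F n in sequentially. norm ((1 / real n) *\<^sub>R (\<Sum>k<n. x k)) \<le> K / sqrt (real n)"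
  proof (rule eventually_sequentiallyI[of 1])
    fix n :: nat assume n: "1 \<le> n"
    have "norm (\<Sum>k<n. x k) \<le> sqrt (real n * K\<^sup>2)"
      using norm_sum_le_of_inner_le[OF assms] by (intro real_le_rsqrt)
    also have "\<dots> = sqrt (real n) * K" using K by (simp add: real_sqrt_mult)
    finally have "norm (\<Sum>k<n. x k) / real n \<le> sqrt (real n) * K / real n"
      by (rule divide_right_mono) simp
    also have "\<dots> = K / sqrt (real n)"
      using n by (simp add: field_simps)
    finally show "norm ((1 / real n) *\<^sub>R (\<Sum>k<n. x k)) \<le> K / sqrt (real n)" by simp
  qed
  show "(\<lambda>n. K / sqrt (real n)) \<longlonglongrightarrow> 0"
    by (intro tendsto_divide_0[OF tendsto_const] filterlim_at_top_imp_at_infinity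
      filterlim_compose[OF sqrt_at_top] filterlim_real_sequentially)
qed

subsection \<open>Law of large numbers for the sampled actions\<close>

text \<open>Along the squares \<open>n = m^2\<close> the second moments of \<open>Y n / n\<close>
  are at most \<open>C / m^2\<close>, hence summable, which gives almost sure convergence there.
  Bounded increments fill the gaps, whose length is of order \<open>m\<close>.\<close>

lemma (in prob_space) sublinear_of_second_moment:
  fixes Y :: "nat \<Rightarrow> 'a \<Rightarrow> real"
  assumes meas: "\<And>n. Y n \<in> borel_measurable M"
    and Y0: "\<And>\<omega>. Y 0 \<omega> = 0" and inc: "\<And>n \<omega>. \<bar>Y (Suc n) \<omega> - Y n \<omega>\<bar> \<le> K"
    and mom: "\<And>n. expectation (\<lambda>\<omega>. (Y n \<omega>)\<^sup>2) \<le> real n * C"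
  shows "AE \<omega> in M. (\<lambda>n. Y n \<omega> / real n) \<longlonglongrightarrow> 0"
proof -
  have K: "0 \<le> K" using inc[of 0 undefined] by linarith
  have diff: "\<bar>Y (m + d) \<omega> - Y m \<omega>\<bar> \<le> real d * K" for m d \<omega>
  proof (induction d)
    case (Suc d)
    then show ?case using inc[of "m + d" \<omega>] by (simp add: algebra_simps)
  qed simp
  have bound: "\<bar>Y n \<omega>\<bar> \<le> real n * K" for n \<omega>
    using diff[of 0 n \<omega>] Y0 by simp
  let ?f = "\<lambda>m \<omega>. (Y ((Suc m)\<^sup>2) \<omega> / real ((Suc m)\<^sup>2))\<^sup>2"
  have fm: "?f m \<in> borel_measurable M" for m
    by (intro borel_measurable_power borel_measurable_divide meas borel_measurable_const)
  have int: "integrable M (?f m)" for m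
  proof (rule integrable_const_bound[where B = "K\<^sup>2"])
    show "AE \<omega> in M. norm (?f m \<omega>) \<le> K\<^sup>2"
    proof (rule AE_I2)
      fix \<omega>
      have "\<bar>Y ((Suc m)\<^sup>2) \<omega>\<bar> / real ((Suc m)\<^sup>2) \<le> K"
        using bound[of "(Suc m)\<^sup>2" \<omega>] by (subst pos_divide_le_eq) (auto simp: mult.commute simp del: of_nat_power)
      then have "(\<bar>Y ((Suc m)\<^sup>2) \<omega>\<bar> / real ((Suc m)\<^sup>2))\<^sup>2 \<le> K\<^sup>2" by (intro power_mono) auto
      then show "norm (?f m \<omega>) \<le> K\<^sup>2" by (simp add: power_divide)
    qed
    show "?f m \<in> borel_measurable M" by (rule fm)
  qed
  have le: "expectation (?f m) \<le> C * (1 / (real (Suc m))\<^sup>2)" for m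
  proof -
    let ?N = "real ((Suc m)\<^sup>2)"
    have N: "0 < ?N" by simp
    have "expectation (?f m) = expectation (\<lambda>\<omega>. (Y ((Suc m)\<^sup>2) \<omega>)\<^sup>2) / ?N\<^sup>2"
      by (simp only: power_divide integral_divide_zero)
    also have "\<dots> \<le> (?N * C) / ?N\<^sup>2" by (rule divide_right_mono[OF mom]) simp
    also have "\<dots> = C * (1 / ?N)" using N by (simp only: power2_eq_square[of ?N]) (simp del: of_nat_power)
    finally show ?thesis by simp
  qed
  \<comment> \<open>The moment bound at \<open>n = 1\<close> forces \<open>C\<close> to be
    nonnegative, as the sum in \<open>ennreal\<close> requires.\<close>
  have "0 \<le> expectation (\<lambda>\<omega>. (Y 1 \<omega>)\<^sup>2)" by (rule Bochner_Integration.integral_nonneg) simp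
  also note mom[of 1]
  finally have C: "0 \<le> C" by simp
  have "(\<integral>\<^sup>+\<omega>. (\<Sum>m. ennreal (?f m \<omega>)) \<partial>M) = (\<Sum>m. \<integral>\<^sup>+\<omega>. ennreal (?f m \<omega>) \<partial>M)"
    by (intro nn_integral_suminf measurable_compose[OF fm measurable_ennreal])
  also have "\<dots> = (\<Sum>m. ennreal (expectation (?f m)))"
    using int by (subst nn_integral_eq_integral) auto
  also have "\<dots> \<le> (\<Sum>m. ennreal (C * (1 / (real (Suc m))\<^sup>2)))"
    by (intro suminf_le ennreal_leI le) auto
  also have "\<dots> < top"
  proof -
    have "summable (\<lambda>m. C * (1 / (real (Suc m))\<^sup>2))"
      using inverse_squares_sums by (intro summable_mult) (auto simp: sums_iff add.commute)
    then show ?thesis using C by (subst suminf_ennreal2) auto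
  qed
  finally have "AE \<omega> in M. (\<Sum>m. ennreal (?f m \<omega>)) \<noteq> \<infinity>"
    by (intro nn_integral_PInf_AE borel_measurable_suminf_order measurable_compose[OF fm measurable_ennreal])
      (simp only: infinity_ennreal_def less_top)
  then show ?thesis
  proof (rule AE_mp, intro AE_I2 impI)
    fix \<omega> assume fin: "(\<Sum>m. ennreal (?f m \<omega>)) \<noteq> \<infinity>"
    have "summable (\<lambda>m. ?f m \<omega>)" using fin by (intro summable_suminf_not_top) auto
    then have "(\<lambda>m. sqrt (?f m \<omega>)) \<longlonglongrightarrow> sqrt 0"
      by (intro tendsto_real_sqrt summable_LIMSEQ_zero)
    then have sq: "(\<lambda>m. \<bar>Y ((Suc m)\<^sup>2) \<omega>\<bar> / real ((Suc m)\<^sup>2) + 2 * K / real (Suc m)) \<longlonglongrightarrow> 0 + 0"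
      by (intro tendsto_add tendsto_divide_0[OF tendsto_const] filterlim_at_top_imp_at_infinity
          filterlim_compose[OF filterlim_real_sequentially filterlim_Suc]) (simp del: of_nat_power of_nat_Suc)
    \<comment> \<open>The squares are indexed by \<open>Suc m\<close>, to avoid division by 0; hence
      the shift. For \<open>n \<ge> 1\<close>, \<open>Suc (?m n)\<close> is the integer square root
      of \<open>n\<close>.\<close>
    let ?m = "\<lambda>n. nat \<lfloor>sqrt (real n)\<rfloor> - 1"
    have lim: "filterlim ?m sequentially sequentially" by real_asymp
    show "(\<lambda>n. Y n \<omega> / real n) \<longlonglongrightarrow> 0"
    proof (rule Lim_null_comparison)
      show "(\<lambda>n. \<bar>Y ((Suc (?m n))\<^sup>2) \<omega>\<bar> / real ((Suc (?m n))\<^sup>2) + 2 * K / real (Suc (?m n))) \<longlonglongrightarrow> 0"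
        using filterlim_compose[OF sq lim] by simp
      show "\<forall>\<^sub>F n in sequentially. norm (Y n \<omega> / real n) \<le>
          \<bar>Y ((Suc (?m n))\<^sup>2) \<omega>\<bar> / real ((Suc (?m n))\<^sup>2) + 2 * K / real (Suc (?m n))"
      proof (rule eventually_sequentiallyI[of 1])
        fix n :: nat assume n: "1 \<le> n"
        define r where "r = Suc (?m n)"
        have "1 \<le> \<lfloor>sqrt (real n)\<rfloor>" using n by (simp add: le_floor_iff)
        then have r: "real r = of_int \<lfloor>sqrt (real n)\<rfloor>" "0 < r" unfolding r_def by auto
        have "real r \<le> sqrt (real n)" "sqrt (real n) < real r + 1" unfolding r by linarith+
        then have "(real r)\<^sup>2 \<le> (sqrt (real n))\<^sup>2" "(sqrt (real n))\<^sup>2 < (real r + 1)\<^sup>2"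
          by (intro power_mono power_strict_mono; simp)+
        then have "real (r\<^sup>2) \<le> real n" "real n < real ((r + 1)\<^sup>2)" by (simp_all add: add.commute)
        then have rn: "r\<^sup>2 \<le> n" "n < (r + 1)\<^sup>2" by linarith+
        then have d: "n - r\<^sup>2 \<le> 2 * r" by (simp add: power2_eq_square)
        have "\<bar>Y n \<omega>\<bar> \<le> \<bar>Y (r\<^sup>2) \<omega>\<bar> + real (n - r\<^sup>2) * K"
          using diff[of "r\<^sup>2" "n - r\<^sup>2" \<omega>] rn(1) by simp
        also have "\<dots> \<le> \<bar>Y (r\<^sup>2) \<omega>\<bar> + real (2 * r) * K"
          using d K by (intro add_left_mono mult_right_mono) auto
        finally have "\<bar>Y n \<omega>\<bar> / real n \<le> (\<bar>Y (r\<^sup>2) \<omega>\<bar> + real (2 * r) * K) / real (r\<^sup>2)"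
          using rn(1) r(2) n K by (intro frac_le) (auto simp del: of_nat_power)
        also have "\<dots> = \<bar>Y (r\<^sup>2) \<omega>\<bar> / real (r\<^sup>2) + 2 * K / real r"
          using r(2) by (simp add: add_divide_distrib power2_eq_square)
        finally show "norm (Y n \<omega> / real n) \<le>
          \<bar>Y ((Suc (?m n))\<^sup>2) \<omega>\<bar> / real ((Suc (?m n))\<^sup>2) + 2 * K / real (Suc (?m n))"
          by (simp add: r_def)
      qed
    qed
  qed
qed

section \<open>Laws of finite histories\<close>

lemma length_history [simp]: "length (history a z n \<omega>) = n"
  by (simp add: history_def)

lemma history_0 [simp]: "history a z 0 \<omega> = []"
  by (simp add: history_def)

lemma history_Suc: "history a z (Suc n) \<omega> = history a z n \<omega> @ [(a n \<omega>, z n \<omega>)]"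
  by (simp add: history_def)

lemma take_history: "k \<le> n \<Longrightarrow> take k (history a z n \<omega>) = history a z k \<omega>"
  by (simp add: history_def take_map)

lemma nth_history: "k < n \<Longrightarrow> history a z n \<omega> ! k = (a k \<omega>, z k \<omega>)"
  by (simp add: history_def)

lemma sets_history_eq:
  fixes a :: "nat \<Rightarrow> 'w \<Rightarrow> 'a::finite" and z :: "nat \<Rightarrow> 'w \<Rightarrow> 'z::finite"
  assumes "is_play M \<sigma> \<tau> a z"
  shows "{\<omega> \<in> space M. history a z n \<omega> = h} \<in> sets M"
    and "{\<omega> \<in> space M. a n \<omega> = x \<and> z n \<omega> = y} \<in> sets M"
proof -
  have meas: "a k \<in> M \<rightarrow>\<^sub>M count_space UNIV" "z k \<in> M \<rightarrow>\<^sub>M count_space UNIV" for k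
    using assms by (auto simp: is_play_def)
  have az: "{\<omega> \<in> space M. a n \<omega> = x \<and> z n \<omega> = y} \<in> sets M" for n x y
  proof (rule sets.sets_Collect_conj)
    show "{\<omega> \<in> space M. a n \<omega> = x} \<in> sets M"
      using measurable_sets[OF meas(1), of "{x}" n] by (simp add: vimage_def Collect_conj_eq Int_commute)
    show "{\<omega> \<in> space M. z n \<omega> = y} \<in> sets M"
      using measurable_sets[OF meas(2), of "{y}" n] by (simp add: vimage_def Collect_conj_eq Int_commute)
  qed
  show "{\<omega> \<in> space M. a n \<omega> = x \<and> z n \<omega> = y} \<in> sets M" by (rule az)
  show "{\<omega> \<in> space M. history a z n \<omega> = h} \<in> sets M"
  proof (induction n arbitrary: h)
    case (Suc n)
    show ?case
    proof (cases h rule: rev_cases)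
      case (snoc h' xy)
      have "{\<omega> \<in> space M. history a z (Suc n) \<omega> = h} =
          {\<omega> \<in> space M. history a z n \<omega> = h' \<and> (a n \<omega> = fst xy \<and> z n \<omega> = snd xy)}"
        by (auto simp: history_Suc snoc prod_eq_iff)
      then show ?thesis by (simp only: sets.sets_Collect_conj[OF az Suc.IH])
    qed (simp add: history_Suc)
  qed simp
qed

text \<open>The product form extends the conditional law to histories of probability 0, where both
  sides vanish.\<close>

lemma prob_history_step:
  fixes a :: "nat \<Rightarrow> 'w \<Rightarrow> 'a::finite" and z :: "nat \<Rightarrow> 'w \<Rightarrow> 'z::finite"
  assumes play: "is_play M \<sigma> \<tau> a z"
  shows "\<P>(\<omega> in M. history a z n \<omega> = h \<and> a n \<omega> = x \<and> z n \<omega> = y) =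
    \<P>(\<omega> in M. history a z n \<omega> = h) * (\<sigma> h $ x * \<tau> h $ y)"
proof -
  interpret prob_space M using play by (simp add: is_play_def)
  show ?thesis
  proof (cases "\<P>(\<omega> in M. history a z n \<omega> = h) > 0")
    case True
    then have "\<P>(\<omega> in M. a n \<omega> = x \<and> z n \<omega> = y \<bar> history a z n \<omega> = h) = \<sigma> h $ x * \<tau> h $ y"
      using play unfolding is_play_def by blast
    with True show ?thesis
      by (simp add: cond_prob_def divide_simps conj_ac)
  next
    case False
    then have "\<P>(\<omega> in M. history a z n \<omega> = h) = 0" using measure_nonneg[of M] by (meson antisym not_less)
    moreover have "\<P>(\<omega> in M. history a z n \<omega> = h \<and> a n \<omega> = x \<and> z n \<omega> = y) \<le> \<P>(\<omega> in M. history a z n \<omega> = h)"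
      by (rule finite_measure_mono) (auto intro: sets_history_eq[OF play])
    ultimately show ?thesis using measure_nonneg[of M] by (simp add: order_antisym)
  qed
qed

lemma finite_lists_of_length: "finite {h :: 'a::finite list. length h = n}"
  using finite_lists_length_eq[of "UNIV :: 'a set" n] by simp

text \<open>There are finitely many histories of each length, so expectations are finite sums and
  the one-step average in the last equation takes the place of a conditional expectation.\<close>

lemma expectation_history:
  fixes a :: "nat \<Rightarrow> 'w \<Rightarrow> 'a::finite" and z :: "nat \<Rightarrow> 'w \<Rightarrow> 'z::finite" and F :: "('a, 'z) hist \<Rightarrow> real"
  assumes play: "is_play M \<sigma> \<tau> a z"
  shows "(\<lambda>\<omega>. F (history a z n \<omega>)) \<in> borel_measurable M"
    and "(\<integral>\<omega>. F (history a z n \<omega>) \<partial>M) = (\<Sum>h | length h = n. F h * \<P>(\<omega> in M. history a z n \<omega> = h))"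
    and "(\<integral>\<omega>. F (history a z (Suc n) \<omega>) \<partial>M) =
      (\<Sum>h | length h = n. \<P>(\<omega> in M. history a z n \<omega> = h) *
        (\<Sum>x\<in>UNIV. \<Sum>y\<in>UNIV. \<sigma> h $ x * \<tau> h $ y * F (h @ [(x, y)])))"
proof -
  interpret prob_space M using play by (simp add: is_play_def)
  let ?H = "{h :: ('a, 'z) hist. length h = n}"
  let ?E = "\<lambda>h. {\<omega> \<in> space M. history a z n \<omega> = h}"
  let ?E' = "\<lambda>h x y. {\<omega> \<in> space M. history a z n \<omega> = h \<and> a n \<omega> = x \<and> z n \<omega> = y}"
  note fin = finite_lists_of_length[of n, where 'a = "'a \<times> 'z"]
  have E: "?E h \<in> sets M" "?E' h x y \<in> sets M" for h x y
    using sets_history_eq[OF play] sets.sets_Collect_conj[OF sets_history_eq[OF play]] by auto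
  have eq: "F (history a z n \<omega>) = (\<Sum>h\<in>?H. F h * indicator (?E h) \<omega>)" if "\<omega> \<in> space M" for \<omega>
  proof -
    have "(\<Sum>h\<in>?H. F h * indicator (?E h) \<omega>) = (\<Sum>h\<in>?H. if h = history a z n \<omega> then F h else 0)"
      using that by (intro sum.cong) auto
    then show ?thesis using fin by simp
  qed
  have "(\<lambda>\<omega>. \<Sum>h\<in>?H. F h * indicator (?E h) \<omega>) \<in> borel_measurable M"
    using E(1) by (intro borel_measurable_sum borel_measurable_times borel_measurable_const borel_measurable_indicator)
  then show "(\<lambda>\<omega>. F (history a z n \<omega>)) \<in> borel_measurable M"
    by (rule measurable_cong[THEN iffD2, rotated]) (rule eq)
  have int: "integrable M (\<lambda>\<omega>. F h * indicator A \<omega>)" if "A \<in> sets M" for A and h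
    using that by (intro integrable_mult_right) (simp add: emeasure_eq_measure)
  have "(\<integral>\<omega>. F (history a z n \<omega>) \<partial>M) = (\<integral>\<omega>. (\<Sum>h\<in>?H. F h * indicator (?E h) \<omega>) \<partial>M)"
    using eq by (intro Bochner_Integration.integral_cong) auto
  also have "\<dots> = (\<Sum>h\<in>?H. \<integral>\<omega>. F h * indicator (?E h) \<omega> \<partial>M)"
    using int[OF E(1)] by (intro Bochner_Integration.integral_sum)
  also have "\<dots> = (\<Sum>h\<in>?H. F h * \<P>(\<omega> in M. history a z n \<omega> = h))"
    using E(1) by simp
  finally show "(\<integral>\<omega>. F (history a z n \<omega>) \<partial>M) = (\<Sum>h\<in>?H. F h * \<P>(\<omega> in M. history a z n \<omega> = h))" .
  have eq': "F (history a z (Suc n) \<omega>) = (\<Sum>h\<in>?H. \<Sum>x\<in>UNIV. \<Sum>y\<in>UNIV. F (h @ [(x, y)]) * indicator (?E' h x y) \<omega>)"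
    if "\<omega> \<in> space M" for \<omega>
  proof -
    have "F (h @ [(x, y)]) * indicator (?E' h x y) \<omega> =
        (if y = z n \<omega> then if x = a n \<omega> then if h = history a z n \<omega> then F (h @ [(x, y)]) else 0 else 0 else 0)"
      for h x y
      using that by auto
    then show ?thesis using fin by (simp add: history_Suc)
  qed
  have "(\<integral>\<omega>. F (history a z (Suc n) \<omega>) \<partial>M) =
      (\<integral>\<omega>. (\<Sum>h\<in>?H. \<Sum>x\<in>UNIV. \<Sum>y\<in>UNIV. F (h @ [(x, y)]) * indicator (?E' h x y) \<omega>) \<partial>M)"
    using eq' by (intro Bochner_Integration.integral_cong) auto
  also have "\<dots> = (\<Sum>h\<in>?H. \<Sum>x\<in>UNIV. \<Sum>y\<in>UNIV. \<integral>\<omega>. F (h @ [(x, y)]) * indicator (?E' h x y) \<omega> \<partial>M)"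
    by (intro trans[OF Bochner_Integration.integral_sum] sum.cong refl Bochner_Integration.integrable_sum
        int[OF E(2)])
  also have "\<dots> = (\<Sum>h\<in>?H. \<Sum>x\<in>UNIV. \<Sum>y\<in>UNIV. F (h @ [(x, y)]) *
      \<P>(\<omega> in M. history a z n \<omega> = h \<and> a n \<omega> = x \<and> z n \<omega> = y))"
    using E(2) by simp
  finally show "(\<integral>\<omega>. F (history a z (Suc n) \<omega>) \<partial>M) =
      (\<Sum>h\<in>?H. \<P>(\<omega> in M. history a z n \<omega> = h) *
        (\<Sum>x\<in>UNIV. \<Sum>y\<in>UNIV. \<sigma> h $ x * \<tau> h $ y * F (h @ [(x, y)])))"
    unfolding prob_history_step[OF play] by (simp add: sum_distrib_left mult_ac)
qed

lemma expectation_history_le: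
  fixes a :: "nat \<Rightarrow> 'w \<Rightarrow> 'a::finite" and z :: "nat \<Rightarrow> 'w \<Rightarrow> 'z::finite" and F :: "('a, 'z) hist \<Rightarrow> real"
  assumes play: "is_play M \<sigma> \<tau> a z"
    and drift: "\<And>h. (\<Sum>x\<in>UNIV. \<Sum>y\<in>UNIV. \<sigma> h $ x * \<tau> h $ y * F (h @ [(x, y)])) \<le> F h + C"
  shows "(\<integral>\<omega>. F (history a z n \<omega>) \<partial>M) \<le> F [] + real n * C"
proof (induction n)
  interpret prob_space M using play by (simp add: is_play_def)
  case 0
  show ?case by (simp add: prob_space)
next
  interpret prob_space M using play by (simp add: is_play_def)
  case (Suc n)
  let ?H = "{h :: ('a, 'z) hist. length h = n}"
  let ?P = "\<lambda>h. \<P>(\<omega> in M. history a z n \<omega> = h)"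
  have "(\<integral>\<omega>. F (history a z (Suc n) \<omega>) \<partial>M) \<le> (\<Sum>h\<in>?H. ?P h * (F h + C))"
    unfolding expectation_history(3)[OF play] by (intro sum_mono mult_left_mono drift) auto
  also have "\<dots> = (\<Sum>h\<in>?H. F h * ?P h) + C * (\<Sum>h\<in>?H. 1 * ?P h)"
    by (simp add: algebra_simps sum.distrib sum_distrib_left)
  also have "\<dots> = (\<integral>\<omega>. F (history a z n \<omega>) \<partial>M) + C * (\<integral>\<omega>. 1 \<partial>M)"
    unfolding expectation_history(2)[OF play, of F] expectation_history(2)[OF play, of "\<lambda>_. 1", where n = n] by simp
  finally show ?case using Suc.IH by (simp add: prob_space algebra_simps)
qed

text \<open>A martingale under the law of the play: each difference compares the sampled action with
  the mixed action it was drawn from, against the same action of the opponent.\<close>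

definition sampling_error ::
    "('a::finite \<Rightarrow> 'z \<Rightarrow> real) \<Rightarrow> (('a, 'z) hist \<Rightarrow> real ^ 'a) \<Rightarrow> ('a, 'z) hist \<Rightarrow> real" where
  "sampling_error w \<sigma> h =
     (\<Sum>k<length h. w (fst (h ! k)) (snd (h ! k)) - mix_left w (\<sigma> (take k h)) (snd (h ! k)))"

lemma sampling_error_append:
  "sampling_error w \<sigma> (h @ [(x, y)]) = sampling_error w \<sigma> h + (w x y - mix_left w (\<sigma> h) y)"
  by (simp add: sampling_error_def nth_append)

text \<open>The two actions are drawn independently, so for each fixed \<open>y\<close> the
  difference averages to 0 over \<open>x\<close>. The cross term of the square vanishes and only
  \<open>K^2\<close> is added.\<close>

lemma sampling_error_drift:
  fixes w :: "'a::finite \<Rightarrow> 'z::finite \<Rightarrow> real"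
  assumes s: "s \<in> prob_simplex" and t: "t \<in> prob_simplex" and d: "\<And>x y. \<bar>w x y - mix_left w s y\<bar> \<le> K"
  shows "(\<Sum>x\<in>UNIV. \<Sum>y\<in>UNIV. s $ x * t $ y * (e + (w x y - mix_left w s y))\<^sup>2) \<le> e\<^sup>2 + K\<^sup>2"
proof -
  have prod: "(\<Sum>x\<in>UNIV. \<Sum>y\<in>UNIV. s $ x * t $ y) = 1"
    using s t by (simp add: prob_simplex_def flip: sum_product)
  have zero: "(\<Sum>x\<in>UNIV. \<Sum>y\<in>UNIV. s $ x * t $ y * (w x y - mix_left w s y)) = 0"
  proof -
    have "(\<Sum>x\<in>UNIV. s $ x * t $ y * (w x y - mix_left w s y)) =
        t $ y * ((\<Sum>x\<in>UNIV. s $ x * w x y) - (\<Sum>x\<in>UNIV. s $ x) * mix_left w s y)" for y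
      by (simp add: algebra_simps sum_subtractf sum_distrib_left sum_distrib_right)
    then show ?thesis
      using s by (subst sum.swap) (simp add: prob_simplex_def mix_left_def)
  qed
  have "(\<Sum>x\<in>UNIV. \<Sum>y\<in>UNIV. s $ x * t $ y * (e + (w x y - mix_left w s y))\<^sup>2) \<le>
    (\<Sum>x\<in>UNIV. \<Sum>y\<in>UNIV. s $ x * t $ y * (e\<^sup>2 + K\<^sup>2) + 2 * e * (s $ x * t $ y * (w x y - mix_left w s y)))"
  proof (intro sum_mono)
    fix x y
    have "(w x y - mix_left w s y)\<^sup>2 \<le> K\<^sup>2"
      using power_mono[OF d abs_ge_zero, of x y 2] by simp
    then have "s $ x * t $ y * (w x y - mix_left w s y)\<^sup>2 \<le> s $ x * t $ y * K\<^sup>2"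
      using s t by (intro mult_left_mono) (auto simp: prob_simplex_def)
    moreover have "r * (e + d)\<^sup>2 \<le> r * (e\<^sup>2 + K\<^sup>2) + 2 * e * (r * d)" if "r * d\<^sup>2 \<le> r * K\<^sup>2" for r d
      using that by (simp add: power2_sum algebra_simps)
    ultimately show "s $ x * t $ y * (e + (w x y - mix_left w s y))\<^sup>2 \<le>
        s $ x * t $ y * (e\<^sup>2 + K\<^sup>2) + 2 * e * (s $ x * t $ y * (w x y - mix_left w s y))"
      by blast
  qed
  also have "\<dots> = (\<Sum>x\<in>UNIV. \<Sum>y\<in>UNIV. s $ x * t $ y) * (e\<^sup>2 + K\<^sup>2)
      + 2 * e * (\<Sum>x\<in>UNIV. \<Sum>y\<in>UNIV. s $ x * t $ y * (w x y - mix_left w s y))"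
    by (simp only: sum.distrib sum_distrib_left sum_distrib_right)
  also have "\<dots> = e\<^sup>2 + K\<^sup>2" unfolding prod zero by simp
  finally show ?thesis .
qed

lemma mix_left_bounds:
  assumes "p \<in> prob_simplex" "\<forall>a z. m \<le> w a z" "\<forall>a z. w a z \<le> (M::real)"
  shows "m \<le> mix_left w p z" "mix_left w p z \<le> M"
  using simplex_average_bounds[OF assms(1), of m "\<lambda>a. w a z" M] assms(2,3) by (auto simp: mix_left_def)

lemma sampling_error_sublinear:
  fixes w :: "'a::finite \<Rightarrow> 'z::finite \<Rightarrow> real"
    and a :: "nat \<Rightarrow> 'w \<Rightarrow> 'a" and z :: "nat \<Rightarrow> 'w \<Rightarrow> 'z"
  assumes play: "is_play M \<sigma> \<tau> a z" and \<sigma>: "\<And>h. \<sigma> h \<in> prob_simplex" and \<tau>: "\<And>h. \<tau> h \<in> prob_simplex"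
  shows "AE \<omega> in M. (\<lambda>n. sampling_error w \<sigma> (history a z n \<omega>) / real n) \<longlonglongrightarrow> 0"
proof -
  interpret prob_space M using play by (simp add: is_play_def)
  obtain K where K: "\<forall>x y. - K \<le> w x y" "\<forall>x y. w x y \<le> K" using bounded_payoff[of w] by metis
  have d: "\<bar>w x y - mix_left w (\<sigma> h) y\<bar> \<le> 2 * K" for x y h
    using mix_left_bounds[OF \<sigma> K, of h y] K(1)[rule_format, of x y] K(2)[rule_format, of x y] by linarith
  show ?thesis
  proof (rule sublinear_of_second_moment)
    show "(\<lambda>\<omega>. sampling_error w \<sigma> (history a z n \<omega>)) \<in> borel_measurable M" for n
      by (rule expectation_history(1)[OF play])
    show "sampling_error w \<sigma> (history a z 0 \<omega>) = 0" for \<omega> by (simp add: sampling_error_def)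
    show "\<bar>sampling_error w \<sigma> (history a z (Suc n) \<omega>) - sampling_error w \<sigma> (history a z n \<omega>)\<bar> \<le> 2 * K" for n \<omega>
      using d by (simp add: history_Suc sampling_error_append)
    show "expectation (\<lambda>\<omega>. (sampling_error w \<sigma> (history a z n \<omega>))\<^sup>2) \<le> real n * (2 * K)\<^sup>2" for n
    proof -
      \<comment> \<open>The drift bound is applied to the squared error, which starts at 0 on the
        empty history.\<close>
      have "expectation (\<lambda>\<omega>. (sampling_error w \<sigma> (history a z n \<omega>))\<^sup>2) \<le>
          (sampling_error w \<sigma> [])\<^sup>2 + real n * (2 * K)\<^sup>2"
        by (rule expectation_history_le[OF play]) (simp only: sampling_error_append sampling_error_drift[OF \<sigma> \<tau> d])
      then show ?thesis by (simp add: sampling_error_def)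
    qed
  qed
qed

subsection \<open>The realized ratio\<close>

text \<open>Puts the empirical distribution into the form of an average of vertices, so that
  \<open>lambda_q\<close> is an average of increments.\<close>

lemma empirical_eq_average:
  "empirical h = (1 / real (length h)) *\<^sub>R (\<Sum>k<length h. axis (snd (h ! k)) 1)"
proof -
  have "(\<Sum>k<length h. axis (snd (h ! k)) (1::real) $ z) = real (card {k. k < length h \<and> snd (h ! k) = z})" for z
  proof -
    have "(\<Sum>k<length h. axis (snd (h ! k)) (1::real) $ z) = (\<Sum>k<length h. if snd (h ! k) = z then 1 else 0)"
      by (intro sum.cong) (auto simp: axis_def)
    also have "\<dots> = real (card ({..<length h} \<inter> {k. snd (h ! k) = z}))" by (simp add: sum.If_cases)
    also have "{..<length h} \<inter> {k. snd (h ! k) = z} = {k. k < length h \<and> snd (h ! k) = z}" by auto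
    finally show ?thesis .
  qed
  then show ?thesis by (simp add: vec_eq_iff empirical_def)
qed

lemma empirical_in_prob_simplex:
  assumes "h \<noteq> []"
  shows "empirical h \<in> prob_simplex"
proof -
  have "(\<Sum>z\<in>UNIV. \<Sum>k<length h. axis (snd (h ! k)) (1::real) $ z) =
      (\<Sum>k<length h. \<Sum>z\<in>UNIV. axis (snd (h ! k)) 1 $ z)"
    by (rule sum.swap)
  also have "\<dots> = real (length h)" by (simp add: prob_simplexD(2)[OF axis_in_prob_simplex])
  finally have "(\<Sum>z\<in>UNIV. empirical h $ z) = 1"
    using assms by (simp add: empirical_eq_average flip: sum_divide_distrib)
  then show ?thesis by (simp add: prob_simplex_def empirical_def)
qed

lemma avg_payoff_bounds:
  assumes "h \<noteq> []" "\<forall>x y. m \<le> w x y" "\<forall>x y. w x y \<le> M"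
  shows "m \<le> avg_payoff w h" "avg_payoff w h \<le> M"
proof -
  have "(\<Sum>k<length h. m) \<le> (\<Sum>k<length h. w (fst (h ! k)) (snd (h ! k)))"
    "(\<Sum>k<length h. w (fst (h ! k)) (snd (h ! k))) \<le> (\<Sum>k<length h. M)"
    using assms(2,3) by (intro sum_mono; blast)+
  then show "m \<le> avg_payoff w h" "avg_payoff w h \<le> M"
    using assms(1) by (simp_all add: avg_payoff_def pos_le_divide_eq pos_divide_le_eq mult.commute)
qed

lemma mix_left_pair_payoff: "mix_left (pair_payoff u c) p y = (mix_left u p y, mix_left c p y)"
  by (simp add: mix_left_def pair_payoff_def prod_eq_iff fst_sum snd_sum)

lemma sum_eq_avg_payoff_diff_sampling_error:
  assumes "h \<noteq> []"
  shows "(\<Sum>k<length h. mix_left w (\<sigma> (take k h)) (snd (h ! k))) =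
    real (length h) * avg_payoff w h - sampling_error w \<sigma> h"
  using assms by (simp add: avg_payoff_def sampling_error_def sum_subtractf)

lemma follows_rule_simplex:
  assumes "follows_rule u c \<sigma> qs ps vs"
  shows "\<sigma> h \<in> prob_simplex" "qs h \<in> prob_simplex"
  using assms by (cases "h = []"; force simp: follows_rule_def is_arg_max_def is_arg_min_def)+

text \<open>Both components are stacked into one vector \<open>x k\<close> of a product space;
  Blackwell's condition concerns the sum of the two inner products only. The limits hold for every
  \<omega>.\<close>

lemma lambda_tendsto_0:
  fixes u c :: "'a::finite \<Rightarrow> 'z::finite \<Rightarrow> real"
    and a :: "nat \<Rightarrow> 'w \<Rightarrow> 'a" and z :: "nat \<Rightarrow> 'w \<Rightarrow> 'z"
  assumes rule: "follows_rule u c \<sigma> qs ps vs"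
  shows "(\<lambda>n. lambda_v u c \<sigma> vs (history a z n \<omega>)) \<longlonglongrightarrow> 0"
    and "(\<lambda>n. lambda_q qs (history a z n \<omega>)) \<longlonglongrightarrow> 0"
proof -
  let ?H = "\<lambda>n. history a z n \<omega>"
  define x where "x k = (vs (?H (Suc k)) - mix_left (pair_payoff u c) (\<sigma> (?H k)) (z k \<omega>),
    qs (?H k) - axis (z k \<omega>) 1)" for k
  have avg: "(1 / real n) *\<^sub>R (\<Sum>k<n. x k) = (lambda_v u c \<sigma> vs (?H n), lambda_q qs (?H n))" for n
  proof -
    have "fst (\<Sum>k<n. x k) = (\<Sum>k<n. vs (take (Suc k) (?H n))
        - mix_left (pair_payoff u c) (\<sigma> (take k (?H n))) (snd (?H n ! k)))"
      unfolding fst_sum by (intro sum.cong) (auto simp: x_def take_history nth_history)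
    moreover have "snd (\<Sum>k<n. x k) = (\<Sum>k<n. qs (take k (?H n))) - (\<Sum>k<n. axis (snd (?H n ! k)) 1)"
      unfolding snd_sum sum_subtractf[symmetric]
      by (intro sum.cong) (auto simp: x_def take_history nth_history)
    ultimately show ?thesis
      by (simp add: prod_eq_iff lambda_v_def lambda_q_def empirical_eq_average scaleR_diff_right)
  qed
  obtain U where U: "\<forall>x y. - U \<le> u x y" "\<forall>x y. u x y \<le> U" using bounded_payoff[of u] by metis
  obtain C where C: "\<forall>x y. - C \<le> c x y" "\<forall>x y. c x y \<le> C" using bounded_payoff[of c] by metis
  \<comment> \<open>The term \<open>norm (vs (?H 1))\<close> accounts for the arbitrary first value;
    later values are mixed payoffs.\<close>
  have bound: "norm (x n) \<le> (U + C + norm (vs (?H 1))) + (U + C) + 2" for n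
  proof -
    have UC: "0 \<le> U" "0 \<le> C" 
      using U[rule_format, of undefined undefined] C[rule_format, of undefined undefined] by linarith+
    have "norm (vs (?H (Suc n))) \<le> U + C + norm (vs (?H 1))"
    proof (cases n)
      case 0 then show ?thesis using UC by simp
    next
      case (Suc m)
      then have ne: "?H n \<noteq> []" by (metis length_history list.size(3) nat.distinct(1))
      let ?p = "ps (?H (Suc n))"
      have vs: "vs (?H (Suc n)) = (mix u ?p (qs (?H n)), mix c ?p (qs (?H n)))" and p: "?p \<in> best_mixed u c (qs (?H n))"
        using rule ne by (auto simp: follows_rule_def history_Suc)
      have pS: "?p \<in> prob_simplex" using p by (simp add: best_mixed_def is_arg_max_def)
      have "\<bar>mix u ?p (qs (?H n))\<bar> \<le> U" "\<bar>mix c ?p (qs (?H n))\<bar> \<le> C"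
        using mix_bounds[OF pS follows_rule_simplex(2)[OF rule] U] mix_bounds[OF pS follows_rule_simplex(2)[OF rule] C]
        by (simp_all add: abs_le_iff minus_le_iff)
      then show ?thesis
        unfolding vs using norm_Pair_le[of "mix u ?p (qs (?H n))" "mix c ?p (qs (?H n))"] norm_ge_zero[of "vs (?H 1)"]
        unfolding real_norm_def by linarith
    qed
    moreover have "norm (mix_left (pair_payoff u c) (\<sigma> (?H n)) (z n \<omega>)) \<le> U + C"
    proof -
      have "\<bar>mix_left u (\<sigma> (?H n)) (z n \<omega>)\<bar> \<le> U" "\<bar>mix_left c (\<sigma> (?H n)) (z n \<omega>)\<bar> \<le> C"
        using mix_left_bounds[OF follows_rule_simplex(1)[OF rule] U] mix_left_bounds[OF follows_rule_simplex(1)[OF rule] C]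
        by (simp_all add: abs_le_iff minus_le_iff)
      then show ?thesis
        unfolding mix_left_pair_payoff
        using norm_Pair_le[of "mix_left u (\<sigma> (?H n)) (z n \<omega>)" "mix_left c (\<sigma> (?H n)) (z n \<omega>)"]
        unfolding real_norm_def by linarith
    qed
    moreover have "norm (qs (?H n) - axis (z n \<omega>) 1) \<le> 2"
      using norm_triangle_ineq4[of "qs (?H n)" "axis (z n \<omega>) 1"]
        norm_prob_simplex_le[OF follows_rule_simplex(2)[OF rule, of "?H n"]]
        norm_prob_simplex_le[OF axis_in_prob_simplex[of "z n \<omega>"]] by linarith
    moreover have "norm (x n) \<le> norm (vs (?H (Suc n)) - mix_left (pair_payoff u c) (\<sigma> (?H n)) (z n \<omega>))
        + norm (qs (?H n) - axis (z n \<omega>) 1)"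
      unfolding x_def by (rule norm_Pair_le)
    ultimately show ?thesis
      using norm_triangle_ineq4[of "vs (?H (Suc n))" "mix_left (pair_payoff u c) (\<sigma> (?H n)) (z n \<omega>)"] by linarith
  qed
  have inner: "(\<Sum>k<n. x k) \<bullet> x n \<le> 0" for n
  proof (cases "n = 0")
    case False
    then have ne: "?H n \<noteq> []" by (metis length_history list.size(3))
    have "((1 / real n) *\<^sub>R (\<Sum>k<n. x k)) \<bullet> x n \<le> 0"
      unfolding avg using follows_rule_inner_le[OF rule ne, of "a n \<omega>" "z n \<omega>"] by (simp add: x_def history_Suc)
    then show ?thesis using False by (simp add: divide_le_0_iff)
  qed simp
  have "(\<lambda>n. (lambda_v u c \<sigma> vs (?H n), lambda_q qs (?H n))) \<longlonglongrightarrow> 0"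
    using average_tendsto_0_of_inner_le[OF bound inner] unfolding avg .
  from tendsto_fst[OF this] tendsto_snd[OF this]
  show "(\<lambda>n. lambda_v u c \<sigma> vs (?H n)) \<longlonglongrightarrow> 0" "(\<lambda>n. lambda_q qs (?H n)) \<longlonglongrightarrow> 0"
    by simp_all
qed

text \<open>
  The pure actions \<open>b k\<close> are chosen separately for every \<open>\<rho>\<close>: among the best responses to
  \<open>q\<^sub>k\<^sup>*\<close> some action does at most as well as \<open>p\<^sub>k\<^sup>*\<close> for the linear payoff \<open>u - \<rho> c\<close>. The constant
  \<open>E\<close> absorbs the first stage, where \<open>v\<^sub>1\<^sup>*\<close> is arbitrary.
\<close>

lemma pure_responses_dominated:
  fixes u c :: "'a::finite \<Rightarrow> 'z::finite \<Rightarrow> real"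
    and a :: "nat \<Rightarrow> 'w \<Rightarrow> 'a" and z :: "nat \<Rightarrow> 'w \<Rightarrow> 'z"
  assumes c: "\<forall>x y. 0 < c x y" and rule: "follows_rule u c \<sigma> qs ps vs"
  obtains E where "\<And>n \<rho>. \<bar>\<rho>\<bar> \<le> B \<Longrightarrow> \<exists>b. (\<forall>k. b k \<in> best_pure u c (qs (history a z k \<omega>))) \<and>
    (\<Sum>k<n. mix_right u (b k) (qs (history a z k \<omega>)) - \<rho> * mix_right c (b k) (qs (history a z k \<omega>)))
      \<le> (\<Sum>k<n. fst (vs (history a z (Suc k) \<omega>)) - \<rho> * snd (vs (history a z (Suc k) \<omega>))) + E"
proof -
  let ?H = "\<lambda>n. history a z n \<omega>"
  obtain U where U: "\<forall>x y. - U \<le> u x y" "\<forall>x y. u x y \<le> U" using bounded_payoff[of u] by metis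
  obtain C where C: "0 < C" "\<forall>x y. c x y \<le> C" using bounded_payoff[of c] by metis
  define E where "E = \<bar>U\<bar> + \<bar>B\<bar> * C + \<bar>fst (vs (?H 1))\<bar> + \<bar>B\<bar> * \<bar>snd (vs (?H 1))\<bar>"
  have E0: "0 \<le> E" using C(1) by (simp add: E_def)
  show ?thesis
  proof (rule that[of E])
    fix n and \<rho> :: real assume \<rho>: "\<bar>\<rho>\<bar> \<le> B"
    let ?w = "\<lambda>b k. mix_right u b (qs (?H k)) - \<rho> * mix_right c b (qs (?H k))"
    let ?v = "\<lambda>k. fst (vs (?H (Suc k))) - \<rho> * snd (vs (?H (Suc k)))"
    \<comment> \<open>The whole slack is charged to \<open>k = 0\<close>, so its total stays bounded
      as \<open>n\<close> grows.\<close>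
    have "\<exists>b. b \<in> best_pure u c (qs (?H k)) \<and> ?w b k \<le> ?v k + (if k = 0 then E else 0)" for k
    proof (cases "k = 0")
      case True
      obtain b where b: "b \<in> best_pure u c (qs (?H 0))" using best_pure_nonempty by blast
      have q: "qs (?H 0) \<in> prob_simplex" by (rule follows_rule_simplex(2)[OF rule])
      have m: "0 < mix_right c b (qs (?H 0))" by (rule mix_right_pos[OF c q])
      have "\<forall>x y. 0 \<le> c x y" using c by (simp add: less_imp_le)
      from mix_right_bounds(2)[OF q this C(2)] have "mix_right c b (qs (?H 0)) \<le> C" .
      then have "\<bar>\<rho> * mix_right c b (qs (?H 0))\<bar> \<le> \<bar>B\<bar> * C"
        unfolding abs_mult using \<rho> m by (intro mult_mono) auto
      moreover have "mix_right u b (qs (?H 0)) \<le> U" by (rule mix_right_bounds(2)[OF q U])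
      moreover have "\<bar>\<rho> * snd (vs (?H 1))\<bar> \<le> \<bar>B\<bar> * \<bar>snd (vs (?H 1))\<bar>"
        unfolding abs_mult using \<rho> by (intro mult_right_mono) auto
      ultimately have "?w b 0 \<le> ?v 0 + E" unfolding E_def One_nat_def by linarith
      with b True show ?thesis by auto
    next
      case False
      then have ne: "?H k \<noteq> []" by (metis length_history list.size(3))
      let ?p = "ps (?H (Suc k))"
      have vs: "vs (?H (Suc k)) = (mix u ?p (qs (?H k)), mix c ?p (qs (?H k)))" and p: "?p \<in> best_mixed u c (qs (?H k))"
        using rule ne by (auto simp: follows_rule_def history_Suc)
      obtain b where "b \<in> best_pure u c (qs (?H k))"
        "?w b k \<le> mix u ?p (qs (?H k)) - \<rho> * mix c ?p (qs (?H k))"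
        using best_mixed_imp_pure[OF c follows_rule_simplex(2)[OF rule] p] by blast
      with False vs show ?thesis by auto
    qed
    then obtain b where b: "\<And>k. b k \<in> best_pure u c (qs (?H k))"
      "\<And>k. ?w (b k) k \<le> ?v k + (if k = 0 then E else 0)"
      by metis
    have "(\<Sum>k<n. ?w (b k) k) \<le> (\<Sum>k<n. ?v k) + (\<Sum>k<n. if k = 0 then E else 0)"
      unfolding sum.distrib[symmetric] using b(2) by (intro sum_mono)
    moreover have "(\<Sum>k<n. if k = 0 then E else 0) \<le> E" using E0 by simp
    ultimately have "(\<Sum>k<n. ?w (b k) k) \<le> (\<Sum>k<n. ?v k) + E" by linarith
    with b(1) show "\<exists>b. (\<forall>k. b k \<in> best_pure u c (qs (?H k))) \<and> (\<Sum>k<n. ?w (b k) k) \<le> (\<Sum>k<n. ?v k) + E"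
      by blast
  qed
qed

text \<open>The first \<open>n\<close> values of \<open>qs\<close> form a near-decomposition of the
  empirical distribution. With \<rho> the realized ratio, the realized averages cancel in
  \<open>u - \<rho> c\<close>, and the payoff of the decomposition reduces to errors that vanish on
  average.\<close>

lemma eventually_rho1_le:
  fixes u c :: "'a::finite \<Rightarrow> 'z::finite \<Rightarrow> real"
    and a :: "nat \<Rightarrow> 'w \<Rightarrow> 'a" and z :: "nat \<Rightarrow> 'w \<Rightarrow> 'z"
  assumes c: "\<forall>x y. 0 < c x y" and rule: "follows_rule u c \<sigma> qs ps vs" and \<epsilon>: "0 < \<epsilon>"
    and su: "(\<lambda>n. sampling_error u \<sigma> (history a z n \<omega>) / real n) \<longlonglongrightarrow> 0"
    and sc: "(\<lambda>n. sampling_error c \<sigma> (history a z n \<omega>) / real n) \<longlonglongrightarrow> 0"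
  shows "\<forall>\<^sub>F n in sequentially. rho1 u c (empirical (history a z n \<omega>))
    \<le> avg_payoff u (history a z n \<omega>) / avg_payoff c (history a z n \<omega>) + \<epsilon>"
proof -
  let ?H = "\<lambda>n. history a z n \<omega>"
  let ?lv = "\<lambda>n. lambda_v u c \<sigma> vs (?H n)" and ?lq = "\<lambda>n. lambda_q qs (?H n)"
  obtain cm where cm: "0 < cm" "\<forall>x y. cm \<le> c x y" using positive_payoff_bounded_below[OF c] .
  obtain C where C: "\<forall>x y. c x y \<le> C" using bounded_payoff[of c] by metis
  obtain U where U: "0 < U" "\<forall>x y. - U \<le> u x y" "\<forall>x y. u x y \<le> U" using bounded_payoff[of u] by metis
  \<comment> \<open>Bounds the realized ratio for all \<open>n\<close>. Since \<rho> varies with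
    \<open>n\<close>, both \<open>\<delta>\<close> and \<open>E\<close> must be uniform over this
    range.\<close>
  define B where "B = U / cm"
  obtain \<delta> where \<delta>: "0 < \<delta>" and approx:
    "\<And>\<rho> q J r b. \<bar>\<rho>\<bar> \<le> B \<Longrightarrow> q \<in> prob_simplex \<Longrightarrow> 0 < J \<Longrightarrow>
      (\<And>j. j < J \<Longrightarrow> r j \<in> prob_simplex) \<Longrightarrow> (\<And>j. j < J \<Longrightarrow> b j \<in> best_pure u c (r j)) \<Longrightarrow>
      (\<And>i. (\<Sum>j<J. r j $ i) / real J \<le> q $ i + \<delta>) \<Longrightarrow>
      (\<Sum>j<J. mix_right u (b j) (r j) - \<rho> * mix_right c (b j) (r j)) \<le> \<delta> * real J \<Longrightarrow>
      rho1 u c q \<le> \<rho> + \<epsilon>"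
    using rho1_le_of_near_average[OF c \<epsilon>, of B u thesis] by blast
  obtain E where E: "\<And>n \<rho>. \<bar>\<rho>\<bar> \<le> B \<Longrightarrow> \<exists>b. (\<forall>k. b k \<in> best_pure u c (qs (?H k))) \<and>
    (\<Sum>k<n. mix_right u (b k) (qs (?H k)) - \<rho> * mix_right c (b k) (qs (?H k)))
      \<le> (\<Sum>k<n. fst (vs (?H (Suc k))) - \<rho> * snd (vs (?H (Suc k)))) + E"
    using pure_responses_dominated[OF c rule, of B a z \<omega> thesis] by blast
  note lim = lambda_tendsto_0[OF rule, of a z \<omega>]
  have "(\<lambda>n. norm (?lq n)) \<longlonglongrightarrow> 0" using lim(2) by (rule tendsto_norm_zero)
  then have ev1: "\<forall>\<^sub>F n in sequentially. norm (?lq n) < \<delta>"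
    using \<delta> by (intro order_tendstoD(2)) auto
  \<comment> \<open>Collects every error in the average of \<open>u - \<rho> c\<close>:
    approachability, sampling and the first stage.\<close>
  let ?err = "\<lambda>n. norm (fst (?lv n)) + B * norm (snd (?lv n)) + norm (sampling_error u \<sigma> (?H n) / real n)
    + B * norm (sampling_error c \<sigma> (?H n) / real n) + E / real n"
  have "?err \<longlonglongrightarrow> norm (fst (0 :: real \<times> real)) + B * norm (snd (0 :: real \<times> real)) + norm (0 :: real) + B * norm (0 :: real) + 0"
    by (intro tendsto_add tendsto_mult tendsto_const tendsto_norm tendsto_fst tendsto_snd lim(1) su sc
      tendsto_divide_0[OF tendsto_const] filterlim_at_top_imp_at_infinity filterlim_real_sequentially)
  then have ev2: "\<forall>\<^sub>F n in sequentially. ?err n < \<delta>"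
    using \<delta> by (intro order_tendstoD(2)) auto
  show ?thesis
    using ev1 ev2 eventually_gt_at_top[of 0]
  proof eventually_elim
    case (elim n)
    then have ne: "?H n \<noteq> []" by (metis length_history list.size(3) less_irrefl)
    define \<rho> where "\<rho> = avg_payoff u (?H n) / avg_payoff c (?H n)"
    have ac: "cm \<le> avg_payoff c (?H n)" by (rule avg_payoff_bounds(1)[OF ne cm(2) C])
    have au: "\<bar>avg_payoff u (?H n)\<bar> \<le> U"
      using avg_payoff_bounds[OF ne U(2,3)] by linarith
    have \<rho>B: "\<bar>\<rho>\<bar> \<le> B"
      unfolding \<rho>_def B_def abs_divide using ac au cm(1) by (intro frac_le) auto
    have \<rho>0: "avg_payoff u (?H n) - \<rho> * avg_payoff c (?H n) = 0"
      using ac cm(1) by (simp add: \<rho>_def)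
    obtain b where b: "\<And>k. b k \<in> best_pure u c (qs (?H k))" and
      bw: "(\<Sum>k<n. mix_right u (b k) (qs (?H k)) - \<rho> * mix_right c (b k) (qs (?H k)))
      \<le> (\<Sum>k<n. fst (vs (?H (Suc k))) - \<rho> * snd (vs (?H (Suc k)))) + E"
      using E[OF \<rho>B, of n] by blast
    have lv: "real n *\<^sub>R ?lv n = (\<Sum>k<n. vs (?H (Suc k)))
        - (\<Sum>k<n. mix_left (pair_payoff u c) (\<sigma> (take k (?H n))) (snd (?H n ! k)))"
    proof -
      have "(\<Sum>k<n. vs (take (Suc k) (?H n))) = (\<Sum>k<n. vs (?H (Suc k)))"
        by (intro sum.cong) (auto simp: take_history)
      then show ?thesis using elim(3) by (simp add: lambda_v_def sum_subtractf)
    qed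
    note se = sum_eq_avg_payoff_diff_sampling_error[OF ne, unfolded length_history, of _ \<sigma>]
    have vu: "(\<Sum>k<n. fst (vs (?H (Suc k)))) = real n * fst (?lv n) + (real n * avg_payoff u (?H n) - sampling_error u \<sigma> (?H n))"
      using arg_cong[OF lv, of fst] by (simp add: fst_sum mix_left_pair_payoff se)
    have vc: "(\<Sum>k<n. snd (vs (?H (Suc k)))) = real n * snd (?lv n) + (real n * avg_payoff c (?H n) - sampling_error c \<sigma> (?H n))"
      using arg_cong[OF lv, of snd] by (simp add: snd_sum mix_left_pair_payoff se)
    have "(\<Sum>k<n. fst (vs (?H (Suc k))) - \<rho> * snd (vs (?H (Suc k)))) =
      (\<Sum>k<n. fst (vs (?H (Suc k)))) - \<rho> * (\<Sum>k<n. snd (vs (?H (Suc k))))"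
      by (simp add: sum_subtractf sum_distrib_left)
    also have "\<dots> = real n * (fst (?lv n) - \<rho> * snd (?lv n))
        - (sampling_error u \<sigma> (?H n) - \<rho> * sampling_error c \<sigma> (?H n))
        + real n * (avg_payoff u (?H n) - \<rho> * avg_payoff c (?H n))"
      unfolding vu vc by (simp add: algebra_simps)
    also have "\<dots> = real n * (fst (?lv n) - \<rho> * snd (?lv n)
        - (sampling_error u \<sigma> (?H n) / real n - \<rho> * (sampling_error c \<sigma> (?H n) / real n)))"
      unfolding \<rho>0 using elim(3) by (simp add: algebra_simps)
    finally have vw: "(\<Sum>k<n. fst (vs (?H (Suc k))) - \<rho> * snd (vs (?H (Suc k)))) + E =
        real n * (fst (?lv n) - \<rho> * snd (?lv n)
        - (sampling_error u \<sigma> (?H n) / real n - \<rho> * (sampling_error c \<sigma> (?H n) / real n)) + E / real n)"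
      using elim(3) by (simp add: distrib_left)
    have \<rho>mult: "\<bar>\<rho> * t\<bar> \<le> B * norm t" for t :: real
      unfolding abs_mult real_norm_def using \<rho>B by (intro mult_right_mono) auto
    have le: "fst (?lv n) - \<rho> * snd (?lv n)
        - (sampling_error u \<sigma> (?H n) / real n - \<rho> * (sampling_error c \<sigma> (?H n) / real n)) + E / real n \<le> \<delta>"
      using elim(2) \<rho>mult[of "snd (?lv n)"] \<rho>mult[of "sampling_error c \<sigma> (?H n) / real n"]
      unfolding real_norm_def by linarith
    note bw
    also note vw
    also note mult_left_mono[OF le of_nat_0_le_iff[of n]]
    also have "real n * \<delta> = \<delta> * real n" by (rule mult.commute)
    finally have sum: "(\<Sum>k<n. mix_right u (b k) (qs (?H k)) - \<rho> * mix_right c (b k) (qs (?H k))) \<le> \<delta> * real n" .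
    have near: "(\<Sum>j<n. qs (?H j) $ i) / real n \<le> empirical (?H n) $ i + \<delta>" for i
    proof -
      have "(\<Sum>k<n. qs (take k (?H n))) = (\<Sum>k<n. qs (?H k))"
        by (intro sum.cong) (auto simp: take_history)
      then have "?lq n $ i = (\<Sum>j<n. qs (?H j) $ i) / real n - empirical (?H n) $ i"
        by (simp add: lambda_q_def)
      then show ?thesis using component_le_norm_cart[of "?lq n" i] elim(1) by linarith
    qed
    show ?case
      using approx[OF \<rho>B empirical_in_prob_simplex[OF ne] elim(3) follows_rule_simplex(2)[OF rule] b near sum]
      unfolding \<rho>_def .
  qed
qed

theorem proposition15:
  fixes u c :: "'a::finite \<Rightarrow> 'z::finite \<Rightarrow> real"
    and \<sigma> ps :: "('a, 'z) hist \<Rightarrow> real ^ 'a"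
    and qs \<tau> :: "('a, 'z) hist \<Rightarrow> real ^ 'z"
    and vs :: "('a, 'z) hist \<Rightarrow> real \<times> real"
    and M :: "'w measure"
    and a :: "nat \<Rightarrow> 'w \<Rightarrow> 'a" and z :: "nat \<Rightarrow> 'w \<Rightarrow> 'z"
  assumes "\<And>x y. 0 < c x y"
    and "follows_rule u c \<sigma> qs ps vs"
    and "\<And>h. \<tau> h \<in> prob_simplex"
    and "is_play M \<sigma> \<tau> a z"
  shows "AE \<omega> in M.
    0 \<le> liminf (\<lambda>n. ereal (avg_payoff u (history a z n \<omega>) / avg_payoff c (history a z n \<omega>)
                            - rho1 u c (empirical (history a z n \<omega>))))"
proof -
  have c: "\<forall>x y. 0 < c x y" using assms(1) by blast
  note \<sigma> = follows_rule_simplex(1)[OF assms(2)]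
  \<comment> \<open>The exceptional null set comes from the two sampling errors alone, so it is
    fixed before any tolerance is chosen.\<close>
  show ?thesis
    using sampling_error_sublinear[OF assms(4) \<sigma> assms(3), of u] sampling_error_sublinear[OF assms(4) \<sigma> assms(3), of c]
  proof eventually_elim
    case (elim \<omega>)
    show ?case
    proof (subst le_Liminf_iff, intro allI impI)
      fix y :: ereal assume "y < 0"
      \<comment> \<open>As \<open>y\<close> may be minus infinity, a real \<open>r\<close> is
        inserted; \<open>- r\<close> serves as the tolerance.\<close>
      then obtain r where r: "y < ereal r" "ereal r < 0" using ereal_dense2 by blast
      then have "0 < - r" by simp
      from eventually_rho1_le[OF c assms(2) this elim]
      show "\<forall>\<^sub>F n in sequentially. y < ereal (avg_payoff u (history a z n \<omega>) / avg_payoff c (history a z n \<omega>)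
          - rho1 u c (empirical (history a z n \<omega>)))"
      proof eventually_elim
        case (elim n)
        then have "r \<le> avg_payoff u (history a z n \<omega>) / avg_payoff c (history a z n \<omega>)
          - rho1 u c (empirical (history a z n \<omega>))" by linarith
        with r(1) show ?case by (meson ereal_less_eq(3) less_le_trans)
      qed
    qed
  qed
qed

end
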